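(* Let $b>0$, $\sigma>0$, $\alpha,\beta>-1$, $\eta\in\mathbb{R}$, $\mu>0$ with $\beta-\mu>-1$, and let $N\ge0$ be an integer. Let $x_r:=x_r^{(\alpha,\beta,\sigma)}$ and $w_r:=w_r^{(\alpha,\beta,\sigma)}$, $r=0,\dots,N$, be the mapped Gauss–Jacobi nodes and weights. Then the left-sided Erdélyi–Kober fractional differentiation matrix of order $\mu$, ${}^L\mathbf{D}^\mu=({}^ld_{s,i})_{s,i=0}^N$, i.e. the matrix satisfying $${}_0D^\mu_{x,\sigma,\eta}\left[\mathcal{I}_{1,N}v\right](x_s)=\sum_{i=0}^N {}^ld_{s,i}\,v(x_i),\qquad s=0,\dots,N,$$ for every continuous function $v$ on $(0,b)$, has entries $${}^ld_{s,i}=\left(\frac{1}{x_i}\right)^{\sigma(\beta-\eta-\mu)}\sum_{j=0}^N a_j^i\,\frac{\Gamma(j+\beta+1)}{\Gamma(j+\beta-\mu+1)}\;{}^1\mathcal{J}_j^{(\alpha+\mu,\beta-\mu,\mu,\sigma,\eta-\mu)}(x_s),$$ where $$a_j^i=\frac{w_i}{{}^*\gamma_j^{(\alpha,\beta)}}\,P_j^{(\alpha,\beta)}\left(2\left(\frac{x_i}{b}\right)^\sigma-1\right).$$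
   Context: $P_n^{(\alpha,\beta)}$ is the Jacobi polynomial of degree $n$ in the standard normalization $P_n^{(\alpha,\beta)}(1)=\binom{n+\alpha}{n}$. Constants: $\gamma_n^{(\alpha,\beta)}=\frac{2^{\alpha+\beta+1}\Gamma(n+\alpha+1)\Gamma(n+\beta+1)}{(2n+\alpha+\beta+1)\,n!\,\Gamma(n+\alpha+\beta+1)}$ (for $n=0$ the denominator is read as $\Gamma(\alpha+\beta+2)$), and ${}^*\gamma_n^{(\alpha,\beta)}=\frac1\sigma\left(\frac{b^\sigma}{2}\right)^{\alpha+\beta+1}\gamma_n^{(\alpha,\beta)}$. Let $x_r^{(\alpha,\beta)}$, $w_r^{(\alpha,\beta)}$, $r=0,\dots,N$, be the nodes and weights of the $(N+1)$-point Gauss–Jacobi quadrature on $[-1,1]$ for the weight $(1-y)^\alpha(1+y)^\beta$. Mapped nodes and weights: $$x_r^{(\alpha,\beta,\sigma)}=b\left(\frac{1+x_r^{(\alpha,\beta)}}2\right)^{1/\sigma},\qquad w_r^{(\alpha,\beta,\sigma)}=\frac1\sigma\left(\frac{b^\sigma}2\right)^{\alpha+\beta+1}w_r^{(\alpha,\beta)}.$$ Jacobi–Müntz functions of the first kind: ${}^1\mathcal{J}_n^{(\alpha,\beta,\mu,\sigma,\eta)}(x)=x^{\sigma(\beta-\eta-\mu)}P_n^{(\alpha,\beta)}\left(2(x/b)^\sigma-1\right)$. Interpolant: $\mathcal{I}_{1,N}v(x)=\sum_{i=0}^N v(x_i)\left(\frac{x}{x_i}\right)^{\sigma(\beta-\eta-\mu)}h_i^\sigma(x)$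 with $h_i^\sigma(x)=\prod_{j\ne i}\frac{x^\sigma-x_j^\sigma}{x_i^\sigma-x_j^\sigma}$. Left Erdélyi–Kober fractional integral (for $\nu>0$) and derivative (for $n-1<\mu\le n$, $n\in\mathbb{N}$): $${}_0I^\nu_{x,\sigma,\eta}[f](x)=\frac{\sigma x^{-\sigma(\eta+\nu)}}{\Gamma(\nu)}\int_0^x(x^\sigma-t^\sigma)^{\nu-1}t^{\sigma(\eta+1)-1}f(t)\,dt,$$ $${}_0D^\mu_{x,\sigma,\eta}[f](x)=x^{-\sigma\eta}\left(\frac1{\sigma x^{\sigma-1}}\frac{d}{dx}\right)^n x^{\sigma(\eta+n)}\,{}_0I^{n-\mu}_{x,\sigma,\eta+\mu}[f](x),$$ with ${}_0I^0$ the identity. *)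

theory Defs
  imports "HOL-Analysis.Analysis" "HOL-Computational_Algebra.Polynomial"
begin

(* P_n^(alpha,beta)(t) =
     sum_k binom(n+alpha, n-k) binom(n+beta, k) ((t-1)/2)^k ((t+1)/2)^(n-k) *)
definition jacobi_poly :: "real \<Rightarrow> real \<Rightarrow> nat \<Rightarrow> real poly" where
  "jacobi_poly \<alpha> \<beta> n =
     (\<Sum>k\<le>n. smult (((real n + \<alpha>) gchoose (n - k)) * ((real n + \<beta>) gchoose k))
                 ([:-1/2, 1/2:] ^ k * [:1/2, 1/2:] ^ (n - k)))"

lemma poly_jacobi_poly:
  "poly (jacobi_poly \<alpha> \<beta> n) t =
     (\<Sum>k\<le>n. ((real n + \<alpha>) gchoose (n - k)) * ((real n + \<beta>) gchoose k)
               * ((t - 1) / 2) ^ k * ((t + 1) / 2) ^ (n - k))"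
  unfolding jacobi_poly_def poly_sum
  by (intro sum.cong) (simp_all add: field_simps)

lemma poly_jacobi_poly_1: "poly (jacobi_poly \<alpha> \<beta> n) 1 = (real n + \<alpha>) gchoose n"
proof -
  have "poly (jacobi_poly \<alpha> \<beta> n) 1 =
          (\<Sum>k\<le>n. if k = 0 then (real n + \<alpha>) gchoose n else 0)"
    unfolding poly_jacobi_poly by (intro sum.cong) auto
  then show ?thesis by simp
qed

definition jacobi_gamma :: "real \<Rightarrow> real \<Rightarrow> nat \<Rightarrow> real" where
  "jacobi_gamma \<alpha> \<beta> n =
     2 powr (\<alpha> + \<beta> + 1) * Gamma (real n + \<alpha> + 1) * Gamma (real n + \<beta> + 1) /
     (if n = 0 then Gamma (\<alpha> + \<beta> + 2)
      else (2 * real n + \<alpha> + \<beta> + 1) * fact n * Gamma (real n + \<alpha> + \<beta> + 1))"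

definition mapped_factor :: "real \<Rightarrow> real \<Rightarrow> real \<Rightarrow> real \<Rightarrow> real" where
  "mapped_factor b \<sigma> \<alpha> \<beta> = 1 / \<sigma> * (b powr \<sigma> / 2) powr (\<alpha> + \<beta> + 1)"

definition mapped_jacobi_gamma :: "real \<Rightarrow> real \<Rightarrow> real \<Rightarrow> real \<Rightarrow> nat \<Rightarrow> real" where
  "mapped_jacobi_gamma b \<sigma> \<alpha> \<beta> n = mapped_factor b \<sigma> \<alpha> \<beta> * jacobi_gamma \<alpha> \<beta> n"

(* The (N+1)-point rule with distinct nodes y 0, ..., y N in [-1,1] that integrates all
   polynomials of degree at most 2N+1 exactly against (1-t)^alpha (1+t)^beta. This
   determines the pairs (y r, u r) up to the order in which they are listed. *)
definition gauss_jacobi_quadrature ::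
    "real \<Rightarrow> real \<Rightarrow> nat \<Rightarrow> (nat \<Rightarrow> real) \<Rightarrow> (nat \<Rightarrow> real) \<Rightarrow> bool" where
  "gauss_jacobi_quadrature \<alpha> \<beta> N y u \<longleftrightarrow>
     inj_on y {..N} \<and> y ` {..N} \<subseteq> {-1..1} \<and>
     (\<forall>p. degree p \<le> 2 * N + 1 \<longrightarrow>
        (LINT t:{-1..1}|lborel. (1 - t) powr \<alpha> * (1 + t) powr \<beta> * poly p t)
          = (\<Sum>r\<le>N. u r * poly p (y r)))"

definition mapped_node :: "real \<Rightarrow> real \<Rightarrow> real \<Rightarrow> real" where
  "mapped_node b \<sigma> y = b * ((1 + y) / 2) powr (1 / \<sigma>)"

definition mapped_weight :: "real \<Rightarrow> real \<Rightarrow> real \<Rightarrow> real \<Rightarrow> real \<Rightarrow> real" where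
  "mapped_weight b \<sigma> \<alpha> \<beta> u = mapped_factor b \<sigma> \<alpha> \<beta> * u"

definition mapped_jacobi :: "real \<Rightarrow> real \<Rightarrow> real \<Rightarrow> real \<Rightarrow> nat \<Rightarrow> real \<Rightarrow> real" where
  "mapped_jacobi b \<sigma> \<alpha> \<beta> n x = poly (jacobi_poly \<alpha> \<beta> n) (2 * (x / b) powr \<sigma> - 1)"

definition jacobi_muntz1 ::
    "real \<Rightarrow> real \<Rightarrow> real \<Rightarrow> real \<Rightarrow> real \<Rightarrow> real \<Rightarrow> nat \<Rightarrow> real \<Rightarrow> real" where
  "jacobi_muntz1 b \<alpha> \<beta> \<mu> \<sigma> \<eta> n x =
     x powr (\<sigma> * (\<beta> - \<eta> - \<mu>)) * mapped_jacobi b \<sigma> \<alpha> \<beta> n x"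

definition muntz_lagrange :: "real \<Rightarrow> nat \<Rightarrow> (nat \<Rightarrow> real) \<Rightarrow> nat \<Rightarrow> real \<Rightarrow> real" where
  "muntz_lagrange \<sigma> N x i z =
     (\<Prod>j\<in>{..N} - {i}. (z powr \<sigma> - x j powr \<sigma>) / (x i powr \<sigma> - x j powr \<sigma>))"

definition muntz_interpolant1 ::
    "real \<Rightarrow> real \<Rightarrow> real \<Rightarrow> real \<Rightarrow> nat \<Rightarrow> (nat \<Rightarrow> real) \<Rightarrow> (real \<Rightarrow> real) \<Rightarrow> real \<Rightarrow> real" where
  "muntz_interpolant1 \<beta> \<mu> \<sigma> \<eta> N x v z =
     (\<Sum>i\<le>N. v (x i) * (z / x i) powr (\<sigma> * (\<beta> - \<eta> - \<mu>)) * muntz_lagrange \<sigma> N x i z)"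

definition EK_integral :: "real \<Rightarrow> real \<Rightarrow> real \<Rightarrow> (real \<Rightarrow> real) \<Rightarrow> real \<Rightarrow> real" where
  "EK_integral \<nu> \<sigma> \<eta> f x =
     (if \<nu> = 0 then f x
      else \<sigma> * x powr (- \<sigma> * (\<eta> + \<nu>)) / Gamma \<nu> *
           (LINT t:{0<..<x}|lborel.
              (x powr \<sigma> - t powr \<sigma>) powr (\<nu> - 1) * t powr (\<sigma> * (\<eta> + 1) - 1) * f t))"

(* n = nat (ceiling mu) is the unique natural number with n - 1 < mu <= n when mu > 0. *)
definition EK_derivative :: "real \<Rightarrow> real \<Rightarrow> real \<Rightarrow> (real \<Rightarrow> real) \<Rightarrow> real \<Rightarrow> real" where
  "EK_derivative \<mu> \<sigma> \<eta> f x =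
     (let n = nat \<lceil>\<mu>\<rceil> in
      x powr (- \<sigma> * \<eta>) *
      ((\<lambda>g z. 1 / (\<sigma> * z powr (\<sigma> - 1)) * deriv g z) ^^ n)
        (\<lambda>z. z powr (\<sigma> * (\<eta> + real n)) * EK_integral (real n - \<mu>) \<sigma> (\<eta> + \<mu>) f z) x)"

definition left_EK_diff_matrix ::
    "real \<Rightarrow> real \<Rightarrow> real \<Rightarrow> real \<Rightarrow> real \<Rightarrow> nat \<Rightarrow> (nat \<Rightarrow> real) \<Rightarrow> (nat \<Rightarrow> nat \<Rightarrow> real) \<Rightarrow> bool" where
  "left_EK_diff_matrix b \<beta> \<mu> \<sigma> \<eta> N x D \<longleftrightarrow>
     (\<forall>v. continuous_on {0<..<b} v \<longrightarrow>
        (\<forall>s\<le>N. EK_derivative \<mu> \<sigma> \<eta> (muntz_interpolant1 \<beta> \<mu> \<sigma> \<eta> N x v) (x s)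
               = (\<Sum>i\<le>N. D s i * v (x i))))"

end

theory Submission
  imports Defs
begin

text \<open>On powers of \<open>x\<^sup>\<sigma>\<close> the Erdelyi--Kober derivative acts by a quotient of Gamma values, obtained
  from a Beta integral followed by differentiating powers. Applied to the hypergeometric expansion
  of a Jacobi polynomial in \<open>s = (t + 1) / 2\<close>, this quotient changes every coefficient into the
  corresponding one for the parameters \<open>\<alpha> + \<mu>\<close> and \<open>\<beta> - \<mu>\<close>, up to a factor that depends only on the
  degree. The Lagrange basis at the Gauss nodes expands in Jacobi polynomials with the
  coefficients \<open>a\<^sub>j\<^sup>i\<close>, because the quadrature rule evaluates the inner products exactly.\<close>

subsection \<open>Finite differences and binomial coefficients\<close>

text \<open>The exponent \<open>\<beta> - \<eta> - \<mu>\<close> is tuned to the operator: adding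
  \<open>\<eta>\<close> leaves \<open>\<beta> - \<mu> + m\<close> on the m-th power, so
  \<open>\<eta>\<close> drops out of the Gamma quotients and \<open>\<beta> - \<mu> > -1\<close>
  keeps all their arguments positive. The target parameters are a shift that preserves
  \<open>\<alpha> + \<beta>\<close>. The obstacle sits at the origin: the Gauss rule is given only
  as an exact rule with distinct nodes in [-1, 1], and a node at -1 would be mapped to 0, where the
  power formulas and \<open>1 / x i\<close> break down. Excluding it needs strict positivity of
  integrals of squares, which is drawn from the orthogonal expansion itself. The operators are
  evaluated on sums of powers as a whole, so no separate linearity or regularity theory for them
  enters. That the entries are forced comes from testing with functions that are 1 at one node and 0
  at the others.\<close>

lemma alternating_binomial_sum_Suc:
  fixes f :: "nat \<Rightarrow> 'a::comm_ring_1"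
  shows "(\<Sum>k\<le>Suc n. (-1) ^ k * of_nat (Suc n choose k) * f k) =
         (\<Sum>k\<le>n. (-1) ^ k * of_nat (n choose k) * (f k - f (Suc k)))"
proof -
  have "(\<Sum>k\<le>Suc n. (-1) ^ k * of_nat (Suc n choose k) * f k) =
        f 0 + (\<Sum>k\<le>n. (-1) ^ Suc k * of_nat (Suc n choose Suc k) * f (Suc k))"
    by (subst sum.atMost_Suc_shift) simp
  also have "(\<Sum>k\<le>n. (-1) ^ Suc k * of_nat (Suc n choose Suc k) * f (Suc k)) =
      - (\<Sum>k\<le>n. (-1) ^ k * of_nat (n choose k) * f (Suc k))
      + (\<Sum>k\<le>n. (-1) ^ Suc k * of_nat (n choose Suc k) * f (Suc k))"
    by (simp add: sum.distrib [symmetric] sum_negf [symmetric] algebra_simps)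
  also have "f 0 + (- (\<Sum>k\<le>n. (-1) ^ k * of_nat (n choose k) * f (Suc k))
      + (\<Sum>k\<le>n. (-1) ^ Suc k * of_nat (n choose Suc k) * f (Suc k)))
      = (\<Sum>k\<le>Suc n. (-1) ^ k * of_nat (n choose k) * f k)
        - (\<Sum>k\<le>n. (-1) ^ k * of_nat (n choose k) * f (Suc k))"
    by (subst sum.atMost_Suc_shift) simp
  also have "(\<Sum>k\<le>Suc n. (-1) ^ k * of_nat (n choose k) * f k)
      = (\<Sum>k\<le>n. (-1) ^ k * of_nat (n choose k) * f k)"
    by (simp add: binomial_eq_0)
  finally show ?thesis
    by (simp add: sum_subtractf [symmetric] algebra_simps)
qed

text \<open>Both products contain \<open>pochhammer (c + 1) m\<close>; the factors left over are
  \<open>c + 1 + m\<close> and \<open>c\<close>. This is the discrete analogue of differentiating a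
  power.\<close>

lemma pochhammer_diff_shift:
  fixes c :: "'a::comm_ring_1"
  shows "pochhammer (c + 1) (Suc m) - pochhammer c (Suc m) = of_nat (Suc m) * pochhammer (c + 1) m"
  unfolding pochhammer_rec [of c] pochhammer_Suc [of "c + 1"] by (simp add: algebra_simps)

text \<open>As a function of x, \<open>pochhammer (c + x) m\<close> is monic of degree m, and the
  sum is its n-th forward difference at 0. Evaluating at \<open>n - k\<close> rather than k makes
  the result \<open>fact n\<close> without a sign. Each induction step lowers n and m together and
  moves c to \<open>c + 1\<close>.\<close>

lemma alternating_binomial_pochhammer_sum:
  fixes c :: real
  assumes "m \<le> n"
  shows "(\<Sum>k\<le>n. (-1) ^ k * of_nat (n choose k) * pochhammer (c + real (n - k)) m) =
         (if m = n then fact n else 0)"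
  using assms
proof (induction n arbitrary: m c)
  case 0
  then show ?case by simp
next
  case (Suc n)
  show ?case
  proof (cases m)
    case 0
    then show ?thesis
      by (subst alternating_binomial_sum_Suc) simp
  next
    case (Suc m')
    have "(\<Sum>k\<le>Suc n. (-1) ^ k * of_nat (Suc n choose k) * pochhammer (c + real (Suc n - k)) m) =
      (\<Sum>k\<le>n. (-1) ^ k * of_nat (n choose k) *
          (real (Suc m') * pochhammer ((c + 1) + real (n - k)) m'))"
      unfolding alternating_binomial_sum_Suc
    proof (intro sum.cong refl arg_cong2 [where f = "(*)"])
      fix k assume "k \<in> {..n}"
      then have *: "c + real (Suc n - k) = (c + real (n - k)) + 1" "Suc n - Suc k = n - k"
        by (auto simp: of_nat_diff)
      show "pochhammer (c + real (Suc n - k)) m - pochhammer (c + real (Suc n - Suc k)) m =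
          real (Suc m') * pochhammer ((c + 1) + real (n - k)) m'"
        unfolding * Suc pochhammer_diff_shift by (simp add: ac_simps)
    qed
    also have "\<dots> = real (Suc m') * (\<Sum>k\<le>n. (-1) ^ k * of_nat (n choose k) *
          pochhammer ((c + 1) + real (n - k)) m')"
      by (simp only: sum_distrib_left mult_ac)
    also have "\<dots> = real (Suc m') * (if m' = n then fact n else 0)"
      using Suc.IH [of m' "c + 1"] Suc.prems Suc by simp
    finally show ?thesis using Suc by simp
  qed
qed

lemma gbinomial_Vandermonde_atMost:
  fixes a b :: "'a::field_char_0"
  shows "(\<Sum>k\<le>n. (a gchoose (n - k)) * (b gchoose k)) = (a + b) gchoose n"
  using gbinomial_Vandermonde [of b a n] by (simp add: atMost_atLeast0 mult.commute add.commute)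

lemma pos_not_nonpos_Ints: "x > 0 \<Longrightarrow> x \<notin> \<int>\<^sub>\<le>\<^sub>0" for x :: real
  by (auto elim!: nonpos_Ints_cases')

lemma Gamma_real_neq_0: "x > 0 \<Longrightarrow> Gamma x \<noteq> 0" for x :: real
  by (simp add: Gamma_eq_zero_iff pos_not_nonpos_Ints)

lemma gbinomial_Gamma_real:
  fixes a :: real
  assumes "a - real k > -1"
  shows "a gchoose k = Gamma (a + 1) / (fact k * Gamma (a - real k + 1))"
proof -
  have "a - real k + 1 \<notin> \<int>\<^sub>\<le>\<^sub>0"
    using assms by (intro pos_not_nonpos_Ints) auto
  from pochhammer_Gamma [OF this, of k] show ?thesis
    by (simp add: gbinomial_pochhammer' algebra_simps)
qed

subsection \<open>Jacobi polynomials in powers of \<open>(t + 1) / 2\<close>\<close>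

text \<open>The terminating hypergeometric form in \<open>s = (t + 1) / 2\<close>, with the Pochhammer symbols written
  as binomials.\<close>

definition jacobi_coeff :: "real \<Rightarrow> real \<Rightarrow> nat \<Rightarrow> nat \<Rightarrow> real" where
  "jacobi_coeff \<alpha> \<beta> n m =
     (-1) ^ (n - m) * ((real n + \<beta>) gchoose (n - m)) * ((real n + \<alpha> + \<beta> + real m) gchoose m)"

text \<open>After \<open>(s - 1) ^ k\<close> is expanded, the coefficient of
  \<open>s ^ (n - l)\<close> is a sum over k. Trinomial revision extracts the factor
  \<open>(n + \<beta>) gchoose l\<close>, and what remains is a Vandermonde convolution.\<close>

lemma poly_jacobi_poly_shifted:
  "poly (jacobi_poly \<alpha> \<beta> n) (2 * s - 1) = (\<Sum>m\<le>n. jacobi_coeff \<alpha> \<beta> n m * s ^ m)"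
proof -
  let ?A = "\<lambda>k. (real n + \<alpha>) gchoose k" and ?B = "\<lambda>k. (real n + \<beta>) gchoose k"
  have "poly (jacobi_poly \<alpha> \<beta> n) (2 * s - 1) =
      (\<Sum>k\<le>n. ?A (n - k) * ?B k * (s - 1) ^ k * s ^ (n - k))"
    by (simp add: poly_jacobi_poly diff_divide_distrib)
  also have "\<dots> = (\<Sum>k\<le>n. \<Sum>l\<le>k. ?A (n - k) * ?B k *
      (real (k choose l) * (-1) ^ l * s ^ (n - l)))"
  proof (intro sum.cong refl)
    fix k assume "k \<in> {..n}"
    then have k: "k \<le> n" by simp
    have "(s - 1) ^ k = (\<Sum>l\<le>k. real (k choose l) * (-1) ^ l * s ^ (k - l))"
      using binomial_ring [of "-1" s k] by simp
    then have "(s - 1) ^ k * s ^ (n - k) =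
        (\<Sum>l\<le>k. real (k choose l) * (-1) ^ l * (s ^ (k - l) * s ^ (n - k)))"
      by (simp only: sum_distrib_right mult.assoc)
    also have "\<dots> = (\<Sum>l\<le>k. real (k choose l) * (-1) ^ l * s ^ (n - l))"
      using k by (intro sum.cong) (auto simp flip: power_add)
    finally show "?A (n - k) * ?B k * (s - 1) ^ k * s ^ (n - k) =
        (\<Sum>l\<le>k. ?A (n - k) * ?B k * (real (k choose l) * (-1) ^ l * s ^ (n - l)))"
      by (simp add: sum_distrib_left mult.assoc)
  qed
  also have "\<dots> = (\<Sum>l\<le>n. \<Sum>k=l..n. ?A (n - k) * ?B k *
      (real (k choose l) * (-1) ^ l * s ^ (n - l)))"
    unfolding sum.Sigma [OF finite_atMost ballI [OF finite_atMost]]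
      sum.Sigma [OF finite_atMost ballI [OF finite_atLeastAtMost]]
    by (rule sum.reindex_bij_witness [of _ "\<lambda>(l, k). (k, l)" "\<lambda>(k, l). (l, k)"]) auto
  also have "\<dots> = (\<Sum>l\<le>n. jacobi_coeff \<alpha> \<beta> n (n - l) * s ^ (n - l))"
  proof (intro sum.cong refl)
    fix l assume "l \<in> {..n}"
    then have l: "l \<le> n" by simp
    have "(\<Sum>k=l..n. ?A (n - k) * ?B k * (real (k choose l) * (-1) ^ l * s ^ (n - l))) =
        (-1) ^ l * s ^ (n - l) * (\<Sum>k=l..n. ?A (n - k) * (?B k * real (k choose l)))"
      by (simp add: sum_distrib_left mult_ac)
    also have "(\<Sum>k=l..n. ?A (n - k) * (?B k * real (k choose l))) =
        (\<Sum>k=l..n. ?A (n - k) * (?B l * ((real n + \<beta> - real l) gchoose (k - l))))"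
      using gbinomial_trinomial_revision [of l _ "real n + \<beta>"]
      by (intro sum.cong refl) (simp add: binomial_gbinomial)
    also have "\<dots> = ?B l * (\<Sum>k\<le>n - l. ?A (n - l - k) * ((real n + \<beta> - real l) gchoose k))"
    proof -
      have "(\<Sum>k=l..n. ?A (n - k) * (?B l * ((real n + \<beta> - real l) gchoose (k - l)))) =
          (\<Sum>k\<le>n - l. ?A (n - l - k) * (?B l * ((real n + \<beta> - real l) gchoose k)))"
        by (rule sum.reindex_bij_witness [of _ "\<lambda>k. k + l" "\<lambda>k. k - l"]) (use l in auto)
      then show ?thesis by (simp add: sum_distrib_left mult_ac)
    qed
    also have "(\<Sum>k\<le>n - l. ?A (n - l - k) * ((real n + \<beta> - real l) gchoose k)) =
        (real n + \<alpha> + \<beta> + real (n - l)) gchoose (n - l)"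
      unfolding gbinomial_Vandermonde_atMost using l by (simp add: of_nat_diff algebra_simps)
    finally show "(\<Sum>k=l..n. ?A (n - k) * ?B k * (real (k choose l) * (-1) ^ l * s ^ (n - l))) =
        jacobi_coeff \<alpha> \<beta> n (n - l) * s ^ (n - l)"
      using l by (simp add: jacobi_coeff_def mult_ac)
  qed
  also have "\<dots> = (\<Sum>m\<le>n. jacobi_coeff \<alpha> \<beta> n m * s ^ m)"
    by (rule sum.reindex_bij_witness [of _ "\<lambda>m. n - m" "\<lambda>m. n - m"]) auto
  finally show ?thesis .
qed

text \<open>The first binomial of \<open>jacobi_coeff\<close> has
  \<open>Gamma (\<beta> + m + 1)\<close> in its denominator, which the given quotient trades for
  \<open>Gamma (\<beta> - \<mu> + m + 1)\<close>. The second binomial sees only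
  \<open>\<alpha> + \<beta>\<close>, hence the compensating \<open>\<alpha> + \<mu>\<close>.\<close>

lemma jacobi_coeff_shift_parameters:
  assumes "\<beta> > -1" "\<beta> - \<mu> > -1" "m \<le> n"
  shows "jacobi_coeff \<alpha> \<beta> n m * (Gamma (\<beta> + real m + 1) / Gamma (\<beta> - \<mu> + real m + 1)) =
         Gamma (real n + \<beta> + 1) / Gamma (real n + \<beta> - \<mu> + 1) *
         jacobi_coeff (\<alpha> + \<mu>) (\<beta> - \<mu>) n m"
proof -
  have *: "(real n + c) gchoose (n - m) =
      Gamma (real n + c + 1) / (fact (n - m) * Gamma (c + real m + 1))" if "c > -1" for c
    using assms that
    by (subst gbinomial_Gamma_real) (auto simp: of_nat_diff algebra_simps)
  have shift: "real n + (\<beta> - \<mu>) + 1 = real n + \<beta> - \<mu> + 1"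
      "real n + (\<alpha> + \<mu>) + (\<beta> - \<mu>) + real m = real n + \<alpha> + \<beta> + real m"
    by simp_all
  have pos: "Gamma (\<beta> + real m + 1) > 0" "Gamma (\<beta> - \<mu> + real m + 1) > 0"
     "Gamma (real n + \<beta> - \<mu> + 1) > 0"
    using assms by (auto intro!: Gamma_real_pos)
  show ?thesis
    unfolding jacobi_coeff_def * [OF assms(1)] * [OF assms(2)] shift
    using pos by (simp add: divide_simps)
qed

subsection \<open>Orthogonality of the Jacobi polynomials\<close>

text \<open>A bridge from gauge integrals, in which the Beta integral is stated, to Lebesgue
  integrals: nonnegativity gives absolute integrability, and Borel measurability removes the
  completion.\<close>

lemma set_integrable_lborel_nonneg:
  fixes f :: "real \<Rightarrow> real"
  assumes "f \<in> borel_measurable lborel" "S \<in> sets lborel" "f integrable_on S"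
    "\<And>x. x \<in> S \<Longrightarrow> 0 \<le> f x"
  shows "set_integrable lborel S f"
proof -
  have "set_integrable lebesgue S f"
    using assms by (intro nonnegative_absolutely_integrable_1) auto
  moreover have "(\<lambda>x. indicator S x *\<^sub>R f x) \<in> borel_measurable lborel"
    using assms by measurable
  ultimately show ?thesis
    unfolding set_integrable_def by (simp add: integrable_completion)
qed

lemma set_integral_sum_real:
  fixes f :: "'i \<Rightarrow> 'a \<Rightarrow> real"
  assumes "\<And>i. i \<in> I \<Longrightarrow> set_integrable M A (f i)"
  shows "set_integrable M A (\<lambda>t. \<Sum>i\<in>I. f i t)"
    and "(LINT t:A|M. \<Sum>i\<in>I. f i t) = (\<Sum>i\<in>I. LINT t:A|M. f i t)"
  using assms unfolding set_integrable_def set_lebesgue_integral_def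
  by (simp_all add: scaleR_sum_right sum_distrib_left)

text \<open>Shared by two substitutions: the affine map of [-1, 1] onto [0, 1] and
  \<open>t \<mapsto> (t / x) powr \<sigma>\<close> on the open interval from 0 to x. Hence the image
  may be the closed or the open unit interval, which differ by a null set.\<close>

lemma Beta_integral_substitution:
  fixes g g' :: "real \<Rightarrow> real"
  assumes ab: "a > 0" "b > 0"
    and S: "S \<in> sets lborel" and S': "S \<in> sets lebesgue"
    and deriv: "\<And>t. t \<in> S \<Longrightarrow> (g has_field_derivative g' t) (at t within S)"
    and inj: "inj_on g S" and img: "g ` S = {0..1} \<or> g ` S = {0<..<1}"
    and h: "h \<in> borel_measurable lborel"
    and h_eq: "\<And>t. t \<in> S \<Longrightarrow> h t = \<bar>g' t\<bar> * (g t powr (a - 1) * (1 - g t) powr (b - 1))"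
  shows "set_integrable lborel S h" and "(LINT t:S|lborel. h t) = Beta a b"
proof -
  let ?f = "\<lambda>s. s powr (a - 1) * (1 - s) powr (b - 1) :: real"
  have "(?f has_integral Beta a b) (g ` S)"
    using has_integral_Beta_real [OF ab] img by (auto simp: has_integral_Icc_iff_Ioo)
  moreover from this have "?f absolutely_integrable_on g ` S"
    using img by (intro nonnegative_absolutely_integrable_1) auto
  ultimately have "(\<lambda>t. \<bar>g' t\<bar> * ?f (g t)) absolutely_integrable_on S \<and>
      integral S (\<lambda>t. \<bar>g' t\<bar> * ?f (g t)) = Beta a b"
    using has_absolute_integral_change_of_variables_1'
      [where S = S and g = g and g' = g' and f = ?f and b = "Beta a b", OF S' deriv inj]
    by (simp add: has_integral_iff)
  then have "((\<lambda>t. \<bar>g' t\<bar> * ?f (g t)) has_integral Beta a b) S"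
    by (auto simp: has_integral_iff set_lebesgue_integral_eq_integral)
  then have I: "(h has_integral Beta a b) S"
    by (rule has_integral_eq [rotated]) (simp add: h_eq)
  show *: "set_integrable lborel S h"
    using h S I by (intro set_integrable_lborel_nonneg) (auto simp: h_eq)
  show "(LINT t:S|lborel. h t) = Beta a b"
    using set_borel_integral_eq_integral(2) [OF *] I by (simp add: integral_unique)
qed

text \<open>At x = 0 both sides vanish because \<open>0 powr a = 0\<close> for every a, so the
  endpoints of [-1, 1] can be treated together with the interior.\<close>

lemma powr_mult_power_scaled:
  fixes x :: real
  assumes "x \<ge> 0"
  shows "x powr a * (x / 2) ^ k = 2 powr a * (x / 2) powr (a + real k)"
  using assms by (cases "x = 0") (auto simp: powr_add powr_divide powr_realpow [symmetric])

lemma jacobi_weight_Bernstein_integral: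
  fixes \<alpha> \<beta> :: real and k m :: nat
  assumes "\<alpha> > -1" "\<beta> > -1"
  defines "h \<equiv> (\<lambda>t::real. (1 - t) powr \<alpha> * (1 + t) powr \<beta> * (((1 - t) / 2) ^ k * ((1 + t) / 2) ^ m))"
  shows "set_integrable lborel {-1..1} h"
    and "(LINT t:{-1..1}|lborel. h t) =
         2 powr (\<alpha> + \<beta> + 1) * Beta (\<beta> + real m + 1) (\<alpha> + real k + 1)"
proof -
  \<comment> \<open>The two weight factors contribute \<open>2 powr (\<alpha> + \<beta>)\<close>,
    and dt = 2 ds one more factor 2.\<close>
  define C :: real where "C = 2 powr (\<alpha> + \<beta> + 1)"
  have C: "C > 0" by (simp add: C_def)
  have img: "(\<lambda>t::real. (1 + t) / 2) ` {-1..1} = {0..1}"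
  proof safe
    fix s :: real assume "s \<in> {0..1}"
    then show "s \<in> (\<lambda>t. (1 + t) / 2) ` {-1..1}"
      by (intro image_eqI [of _ _ "2 * s - 1"]) auto
  qed auto
  have eq: "h t / C = \<bar>1 / 2\<bar> * (((1 + t) / 2) powr (\<beta> + real m + 1 - 1) *
      (1 - (1 + t) / 2) powr (\<alpha> + real k + 1 - 1))" if "t \<in> {-1..1}" for t
  proof -
    have "h t = ((1 - t) powr \<alpha> * ((1 - t) / 2) ^ k) * ((1 + t) powr \<beta> * ((1 + t) / 2) ^ m)"
      by (simp add: h_def)
    also have "\<dots> = (2 powr \<alpha> * ((1 - t) / 2) powr (\<alpha> + real k)) *
        (2 powr \<beta> * ((1 + t) / 2) powr (\<beta> + real m))"
      using that by (simp add: powr_mult_power_scaled)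
    also have "(1 - t) / 2 = 1 - (1 + t) / 2" by (simp add: field_simps)
    finally show ?thesis by (simp add: C_def powr_add)
  qed
  note subst = Beta_integral_substitution [of "\<beta> + real m + 1" "\<alpha> + real k + 1" "{-1..1}"
    "\<lambda>t. (1 + t) / 2" "\<lambda>_. 1 / 2" "\<lambda>t. h t / C"]
  have prems: "\<beta> + real m + 1 > 0" "\<alpha> + real k + 1 > 0"
    using assms by auto
  have meas: "(\<lambda>t. h t / C) \<in> borel_measurable lborel"
    unfolding h_def by measurable
  have der: "((\<lambda>t. (1 + t) / 2) has_field_derivative 1 / 2) (at t within {-1..1})" for t :: real
    by (auto intro!: derivative_eq_intros)
  have inj: "inj_on (\<lambda>t::real. (1 + t) / 2) {-1..1}"
    by (auto simp: inj_on_def)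
  have "set_integrable lborel {-1..1} (\<lambda>t. h t / C)"
    by (rule subst(1)) (use prems meas der inj img eq in auto)
  moreover have "(LINT t:{-1..1}|lborel. h t / C) = Beta (\<beta> + real m + 1) (\<alpha> + real k + 1)"
    by (rule subst(2)) (use prems meas der inj img eq in auto)
  ultimately show "set_integrable lborel {-1..1} h"
    "(LINT t:{-1..1}|lborel. h t) = 2 powr (\<alpha> + \<beta> + 1) * Beta (\<beta> + real m + 1) (\<alpha> + real k + 1)"
    unfolding C_def [symmetric] using C by (simp_all add: field_simps)
qed

section \<open>The weighted integral as a functional on polynomials\<close>

definition jacobi_integral :: "real \<Rightarrow> real \<Rightarrow> real poly \<Rightarrow> real" where
  "jacobi_integral \<alpha> \<beta> p =
     (LINT t:{-1..1}|lborel. (1 - t) powr \<alpha> * (1 + t) powr \<beta> * poly p t)"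

abbreviation half_shift :: "real poly" where
  "half_shift \<equiv> [:1/2, 1/2:]"

lemma half_shift_expansion:
  assumes "degree p \<le> n"
  obtains c where "p = (\<Sum>m\<le>n. smult (c m) (half_shift ^ m))"
proof
  \<comment> \<open>The polynomial \<open>[:-1, 2:]\<close> is inverse to \<open>half_shift\<close>
    under composition, so the coefficients of \<open>?q\<close> are the required ones; those beyond
    its degree are zero.\<close>
  let ?q = "pcompose p [:-1, 2:]"
  have "degree ?q \<le> n"
    using assms by (simp add: degree_pcompose)
  show "p = (\<Sum>m\<le>n. smult (coeff ?q m) (half_shift ^ m))"
  proof (rule poly_eq_poly_eq_iff [THEN iffD1], rule ext)
    fix t
    have "poly p t = poly ?q (poly half_shift t)"
      by (simp add: poly_pcompose field_simps)
    also have "\<dots> = (\<Sum>m\<le>n. coeff ?q m * poly half_shift t ^ m)"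
      unfolding poly_altdef
      by (rule sum.mono_neutral_left) (use \<open>degree ?q \<le> n\<close> in \<open>auto simp: coeff_eq_0\<close>)
    finally show "poly p t = poly (\<Sum>m\<le>n. smult (coeff ?q m) (half_shift ^ m)) t"
      by (simp add: poly_sum poly_power)
  qed
qed

lemma jacobi_integrable:
  fixes p :: "real poly"
  assumes "\<alpha> > -1" "\<beta> > -1"
  shows "set_integrable lborel {-1..1} (\<lambda>t. (1 - t) powr \<alpha> * (1 + t) powr \<beta> * poly p t)"
proof -
  obtain c where c: "p = (\<Sum>m\<le>degree p. smult (c m) (half_shift ^ m))"
    using half_shift_expansion [of p "degree p"] by auto
  have "poly p t = (\<Sum>m\<le>degree p. c m * ((1 + t) / 2) ^ m)" for t
    by (subst c) (simp add: poly_sum poly_power add_divide_distrib)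
  then have "(\<lambda>t. (1 - t) powr \<alpha> * (1 + t) powr \<beta> * poly p t) =
      (\<lambda>t. \<Sum>m\<le>degree p. c m * ((1 - t) powr \<alpha> * (1 + t) powr \<beta> *
          (((1 - t) / 2) ^ 0 * ((1 + t) / 2) ^ m)))"
    by (simp add: sum_distrib_left mult_ac)
  then show ?thesis
    using jacobi_weight_Bernstein_integral(1) [OF assms, of 0]
    by (simp only:) (auto intro!: set_integral_sum_real set_integrable_mult_right)
qed

lemma jacobi_integral_add:
  assumes "\<alpha> > -1" "\<beta> > -1"
  shows "jacobi_integral \<alpha> \<beta> (p + q) = jacobi_integral \<alpha> \<beta> p + jacobi_integral \<alpha> \<beta> q"
  unfolding jacobi_integral_def
  by (simp add: set_integral_add(2) [OF jacobi_integrable [OF assms] jacobi_integrable [OF assms], symmetric]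
      ring_distribs)

lemma jacobi_integral_smult:
  "jacobi_integral \<alpha> \<beta> (smult c p) = c * jacobi_integral \<alpha> \<beta> p"
  unfolding jacobi_integral_def by (simp flip: set_integral_mult_right add: mult_ac)

lemma jacobi_integral_sum:
  assumes "\<alpha> > -1" "\<beta> > -1"
  shows "jacobi_integral \<alpha> \<beta> (\<Sum>i\<in>I. f i) = (\<Sum>i\<in>I. jacobi_integral \<alpha> \<beta> (f i))"
proof (induction I rule: infinite_finite_induct)
  case (insert i I)
  then show ?case by (simp add: jacobi_integral_add [OF assms])
qed (auto simp: jacobi_integral_def)

text \<open>The only surviving moment, that of order n; it equals
  \<open>2 powr (\<alpha> + \<beta> + 1)\<close> times
  \<open>Beta (n + \<alpha> + 1) (n + \<beta> + 1)\<close>.\<close>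

definition jacobi_moment :: "real \<Rightarrow> real \<Rightarrow> nat \<Rightarrow> real" where
  "jacobi_moment \<alpha> \<beta> n = 2 powr (\<alpha> + \<beta> + 1) * Gamma (real n + \<alpha> + 1) * Gamma (real n + \<beta> + 1) /
     Gamma (2 * real n + \<alpha> + \<beta> + 2)"

text \<open>By the Beta integral each moment is a finite difference of order \<open>n\<close> of a polynomial of
  degree \<open>m\<close>.\<close>

lemma jacobi_integral_jacobi_poly_power:
  assumes "\<alpha> > -1" "\<beta> > -1" "m \<le> n"
  shows "jacobi_integral \<alpha> \<beta> (jacobi_poly \<alpha> \<beta> n * half_shift ^ m) =
         (if m = n then jacobi_moment \<alpha> \<beta> n else 0)"
proof -
  let ?A = "\<lambda>k. (real n + \<alpha>) gchoose k" and ?B = "\<lambda>k. (real n + \<beta>) gchoose k"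
  let ?C = "2 powr (\<alpha> + \<beta> + 1) * Gamma (real n + \<alpha> + 1) * Gamma (real n + \<beta> + 1) /
     (fact n * Gamma (real n + real m + \<alpha> + \<beta> + 2))"
  let ?p = "\<lambda>k. [:1/2, -1/2::real:] ^ k * half_shift ^ (n - k + m)"
  have Bernstein: "jacobi_integral \<alpha> \<beta> (?p k) =
     2 powr (\<alpha> + \<beta> + 1) * Beta (\<beta> + real (n - k + m) + 1) (\<alpha> + real k + 1)" for k
    unfolding jacobi_weight_Bernstein_integral(2) [OF assms(1,2), symmetric] jacobi_integral_def
    by (simp add: poly_power diff_divide_distrib add_divide_distrib)
  \<comment> \<open>Passing from (t - 1) / 2 to (1 - t) / 2 yields the alternating sign of the
    finite difference.\<close>
  have minus: "[:-1/2, 1/2::real:] ^ k = smult ((-1) ^ k) ([:1/2, -1/2:] ^ k)" for k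
    by (simp flip: smult_power)
  have "jacobi_poly \<alpha> \<beta> n * half_shift ^ m =
      (\<Sum>k\<le>n. smult ((-1) ^ k * (?A (n - k) * ?B k)) (?p k))"
    unfolding jacobi_poly_def sum_distrib_right minus power_add
    by (simp add: mult_ac)
  then have "jacobi_integral \<alpha> \<beta> (jacobi_poly \<alpha> \<beta> n * half_shift ^ m) =
      (\<Sum>k\<le>n. (-1) ^ k * (?A (n - k) * ?B k) * jacobi_integral \<alpha> \<beta> (?p k))"
    by (simp only: jacobi_integral_sum [OF assms(1,2)] jacobi_integral_smult)
  also have "\<dots> = (\<Sum>k\<le>n. ?C *
      ((-1) ^ k * of_nat (n choose k) * pochhammer ((\<beta> + 1) + real (n - k)) m))"
  proof (intro sum.cong refl)
    fix k assume "k \<in> {..n}"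
    then have k: "k \<le> n" by simp
    have A: "?A (n - k) = Gamma (real n + \<alpha> + 1) / (fact (n - k) * Gamma (\<alpha> + real k + 1))"
      using assms k by (subst gbinomial_Gamma_real) (auto simp: of_nat_diff algebra_simps)
    have B: "?B k = Gamma (real n + \<beta> + 1) / (fact k * Gamma (\<beta> + real (n - k) + 1))"
      using assms k by (subst gbinomial_Gamma_real) (auto simp: of_nat_diff algebra_simps)
    have P: "pochhammer ((\<beta> + 1) + real (n - k)) m =
        Gamma (\<beta> + real (n - k + m) + 1) / Gamma (\<beta> + real (n - k) + 1)"
      using assms by (subst pochhammer_Gamma) (auto simp: add_ac elim!: nonpos_Ints_cases')
    \<comment> \<open>The two Beta arguments have a sum free of k, so their common Gamma denominator
      can go into \<open>?C\<close>.\<close>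
    have S: "\<beta> + real (n - k + m) + 1 + (\<alpha> + real k + 1) = real n + real m + \<alpha> + \<beta> + 2"
      using k by (simp add: of_nat_diff)
    have "Gamma (\<alpha> + real k + 1) > 0" "Gamma (\<beta> + real (n - k) + 1) > 0"
      using assms by (auto intro!: Gamma_real_pos)
    then show "(-1) ^ k * (?A (n - k) * ?B k) * jacobi_integral \<alpha> \<beta> (?p k) =
        ?C * ((-1) ^ k * of_nat (n choose k) * pochhammer ((\<beta> + 1) + real (n - k)) m)"
      unfolding Bernstein Beta_def A B P S binomial_fact [OF k] by (simp add: divide_simps)
  qed
  also have "\<dots> = ?C * (if m = n then fact n else 0)"
    by (simp only: sum_distrib_left [symmetric] alternating_binomial_pochhammer_sum [OF assms(3)])
  finally show ?thesis
    by (simp add: jacobi_moment_def add_ac)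
qed

lemma jacobi_poly_half_shift:
  "jacobi_poly \<alpha> \<beta> n = (\<Sum>m\<le>n. smult (jacobi_coeff \<alpha> \<beta> n m) (half_shift ^ m))"
proof (rule poly_eq_poly_eq_iff [THEN iffD1], rule ext)
  fix t
  show "poly (jacobi_poly \<alpha> \<beta> n) t =
      poly (\<Sum>m\<le>n. smult (jacobi_coeff \<alpha> \<beta> n m) (half_shift ^ m)) t"
    using poly_jacobi_poly_shifted [of \<alpha> \<beta> n "(1 + t) / 2"]
    by (simp add: poly_sum poly_power add_divide_distrib)
qed

lemma degree_half_shift_sum: "degree (\<Sum>m\<le>n. smult (c m) (half_shift ^ m)) \<le> n"
proof (intro degree_sum_le finite_atMost)
  fix m assume "m \<in> {..n}"
  then show "degree (smult (c m) (half_shift ^ m)) \<le> n"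
    using degree_smult_le [of "c m" "half_shift ^ m"] by (simp add: degree_power_eq)
qed

lemma degree_jacobi_poly_le: "degree (jacobi_poly \<alpha> \<beta> n) \<le> n"
  unfolding jacobi_poly_half_shift by (rule degree_half_shift_sum)

text \<open>All lower powers integrate to zero, so only the top coefficient is felt. A zero top
  coefficient gives orthogonality; the leading coefficient of the Jacobi polynomial gives its
  squared norm.\<close>

lemma jacobi_integral_jacobi_poly_mult:
  assumes "\<alpha> > -1" "\<beta> > -1"
  shows "jacobi_integral \<alpha> \<beta> (jacobi_poly \<alpha> \<beta> n * (\<Sum>m\<le>n. smult (c m) (half_shift ^ m))) =
         c n * jacobi_moment \<alpha> \<beta> n"
proof -
  have "jacobi_integral \<alpha> \<beta> (jacobi_poly \<alpha> \<beta> n * (\<Sum>m\<le>n. smult (c m) (half_shift ^ m))) =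
      (\<Sum>m\<le>n. c m * jacobi_integral \<alpha> \<beta> (jacobi_poly \<alpha> \<beta> n * half_shift ^ m))"
    by (simp only: sum_distrib_left mult_smult_right jacobi_integral_sum [OF assms]
        jacobi_integral_smult)
  also have "\<dots> = (\<Sum>m\<le>n. if m = n then c n * jacobi_moment \<alpha> \<beta> n else 0)"
    by (intro sum.cong refl) (simp add: jacobi_integral_jacobi_poly_power [OF assms])
  finally show ?thesis by simp
qed

lemma jacobi_orthogonal_less:
  assumes "\<alpha> > -1" "\<beta> > -1" "degree q < n"
  shows "jacobi_integral \<alpha> \<beta> (jacobi_poly \<alpha> \<beta> n * q) = 0"
proof -
  obtain c where c: "q = (\<Sum>m\<le>n - 1. smult (c m) (half_shift ^ m))"
    by (rule half_shift_expansion [of q "n - 1"]) (use assms in auto)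
  also have "\<dots> = (\<Sum>m\<le>n. smult (if m = n then 0 else c m) (half_shift ^ m))"
    by (rule sum.mono_neutral_cong_left) (use assms in auto)
  finally show ?thesis
    by (simp only: jacobi_integral_jacobi_poly_mult [OF assms(1,2)]) simp
qed

section \<open>Norms, orthogonal expansions and positivity\<close>

lemma jacobi_gamma_pos:
  assumes "\<alpha> > -1" "\<beta> > -1"
  shows "jacobi_gamma \<alpha> \<beta> n > 0"
proof -
  have "Gamma (real n + \<alpha> + 1) > 0" "Gamma (real n + \<beta> + 1) > 0" "Gamma (\<alpha> + \<beta> + 2) > 0"
    using assms by (auto intro!: Gamma_real_pos)
  \<comment> \<open>From \<open>\<alpha> + \<beta> > -2\<close> this follows only for n at least 1;
    at n = 0 the number \<open>\<alpha> + \<beta> + 1\<close> may be zero or negative, which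
    explains the separate denominator there.\<close>
  moreover have "2 * real n + \<alpha> + \<beta> + 1 > 0 \<and> Gamma (real n + \<alpha> + \<beta> + 1) > 0" if "n > 0"
    using assms that by (auto intro!: Gamma_real_pos)
  ultimately show ?thesis by (simp add: jacobi_gamma_def)
qed

lemma jacobi_leading_coeff_moment:
  assumes "\<alpha> > -1" "\<beta> > -1"
  shows "jacobi_coeff \<alpha> \<beta> n n * jacobi_moment \<alpha> \<beta> n = jacobi_gamma \<alpha> \<beta> n"
proof (cases "n = 0")
  case False
  then have "2 * real n + \<alpha> + \<beta> + 1 > 0" "real n + \<alpha> + \<beta> + 1 > 0"
    using assms by auto
  moreover have "jacobi_coeff \<alpha> \<beta> n n =
      Gamma (2 * real n + \<alpha> + \<beta> + 1) / (fact n * Gamma (real n + \<alpha> + \<beta> + 1))"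
    using calculation unfolding jacobi_coeff_def
    by (subst (2) gbinomial_Gamma_real) (auto simp: algebra_simps)
  moreover have "Gamma (2 * real n + \<alpha> + \<beta> + 2) =
      (2 * real n + \<alpha> + \<beta> + 1) * Gamma (2 * real n + \<alpha> + \<beta> + 1)"
    using Gamma_plus1 [OF pos_not_nonpos_Ints, OF calculation(1)] by (simp add: add_ac)
  moreover have "Gamma (2 * real n + \<alpha> + \<beta> + 1) \<noteq> 0"
    using Gamma_real_neq_0 [OF calculation(1)] .
  ultimately show ?thesis
    using False by (simp add: jacobi_moment_def jacobi_gamma_def mult_ac)
qed (simp add: jacobi_moment_def jacobi_gamma_def jacobi_coeff_def)

lemma jacobi_orthogonality:
  assumes "\<alpha> > -1" "\<beta> > -1"
  shows "jacobi_integral \<alpha> \<beta> (jacobi_poly \<alpha> \<beta> i * jacobi_poly \<alpha> \<beta> j) =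
         (if i = j then jacobi_gamma \<alpha> \<beta> i else 0)"
proof (cases i j rule: linorder_cases)
  case less
  then show ?thesis
    using jacobi_orthogonal_less [OF assms, of "jacobi_poly \<alpha> \<beta> i" j]
      degree_jacobi_poly_le [of \<alpha> \<beta> i] by (simp add: mult.commute)
next
  case equal
  have "jacobi_integral \<alpha> \<beta> (jacobi_poly \<alpha> \<beta> i * jacobi_poly \<alpha> \<beta> i) =
      jacobi_coeff \<alpha> \<beta> i i * jacobi_moment \<alpha> \<beta> i"
    by (subst (2) jacobi_poly_half_shift) (rule jacobi_integral_jacobi_poly_mult [OF assms])
  then show ?thesis
    using equal by (simp add: jacobi_leading_coeff_moment [OF assms])
next
  case greater
  then show ?thesis
    using jacobi_orthogonal_less [OF assms, of "jacobi_poly \<alpha> \<beta> j" i]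
      degree_jacobi_poly_le [of \<alpha> \<beta> j] by simp
qed

text \<open>Triangular elimination: the multiple e of the Jacobi polynomial of top degree removes
  the top coefficient. Its leading coefficient is nonzero because its product with the moment is the
  positive number \<open>jacobi_gamma\<close>.\<close>

lemma jacobi_poly_span:
  assumes "\<alpha> > -1" "\<beta> > -1"
  shows "\<exists>d. (\<Sum>m\<le>n. smult (c m) (half_shift ^ m)) = (\<Sum>j\<le>n. smult (d j) (jacobi_poly \<alpha> \<beta> j))"
proof (induction n arbitrary: c)
  case 0
  show ?case
    by (rule exI [of _ c]) (simp add: jacobi_poly_def)
next
  case (Suc n)
  let ?L = "jacobi_coeff \<alpha> \<beta> (Suc n)"
  define e where "e = c (Suc n) / ?L (Suc n)"
  have "?L (Suc n) \<noteq> 0"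
    using jacobi_leading_coeff_moment [OF assms, of "Suc n"] jacobi_gamma_pos [OF assms, of "Suc n"]
    by auto
  then have c_Suc: "c (Suc n) = e * ?L (Suc n)"
    by (simp add: e_def)
  obtain d where d: "(\<Sum>m\<le>n. smult (c m - e * ?L m) (half_shift ^ m)) =
      (\<Sum>j\<le>n. smult (d j) (jacobi_poly \<alpha> \<beta> j))"
    using Suc.IH [of "\<lambda>m. c m - e * ?L m"] by blast
  have "(\<Sum>m\<le>Suc n. smult (c m) (half_shift ^ m)) =
      (\<Sum>m\<le>Suc n. smult (c m - e * ?L m) (half_shift ^ m)) + smult e (jacobi_poly \<alpha> \<beta> (Suc n))"
  proof -
    have "smult e (jacobi_poly \<alpha> \<beta> (Suc n)) =
        (\<Sum>m\<le>Suc n. smult (e * ?L m) (half_shift ^ m))"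
      unfolding jacobi_poly_half_shift 
      by (rule poly_eqI) (simp only: coeff_sum coeff_smult sum_distrib_left mult.assoc)
    then show ?thesis
      by (simp only: sum.distrib [symmetric] smult_add_left [symmetric]) simp
  qed
  also have "(\<Sum>m\<le>Suc n. smult (c m - e * ?L m) (half_shift ^ m)) =
      (\<Sum>j\<le>n. smult (d j) (jacobi_poly \<alpha> \<beta> j))"
    using d c_Suc by simp
  also have "\<dots> = (\<Sum>j\<le>n. smult (if j = Suc n then e else d j) (jacobi_poly \<alpha> \<beta> j))"
    by (intro sum.cong) auto
  finally show ?case
    by (intro exI [of _ "\<lambda>j. if j = Suc n then e else d j"]) simp
qed

lemma jacobi_expansion:
  assumes "\<alpha> > -1" "\<beta> > -1" "degree p \<le> n"
  shows "p = (\<Sum>j\<le>n. smult (jacobi_integral \<alpha> \<beta> (p * jacobi_poly \<alpha> \<beta> j) / jacobi_gamma \<alpha> \<beta> j)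
               (jacobi_poly \<alpha> \<beta> j))"
proof -
  obtain d where d: "p = (\<Sum>j\<le>n. smult (d j) (jacobi_poly \<alpha> \<beta> j))"
    using half_shift_expansion [OF assms(3)] jacobi_poly_span [OF assms(1,2)] by metis
  have "jacobi_integral \<alpha> \<beta> (p * jacobi_poly \<alpha> \<beta> j) = d j * jacobi_gamma \<alpha> \<beta> j" if "j \<le> n" for j
  proof -
    have "jacobi_integral \<alpha> \<beta> (p * jacobi_poly \<alpha> \<beta> j) =
        (\<Sum>i\<le>n. d i * jacobi_integral \<alpha> \<beta> (jacobi_poly \<alpha> \<beta> i * jacobi_poly \<alpha> \<beta> j))"
      by (simp only: d sum_distrib_right mult_smult_left jacobi_integral_sum [OF assms(1,2)]
          jacobi_integral_smult)
    also have "\<dots> = (\<Sum>i\<le>n. if i = j then d j * jacobi_gamma \<alpha> \<beta> j else 0)"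
      by (intro sum.cong refl) (simp add: jacobi_orthogonality [OF assms(1,2)])
    finally show ?thesis using that by simp
  qed
  moreover have "jacobi_gamma \<alpha> \<beta> j \<noteq> 0" for j
    using jacobi_gamma_pos [OF assms(1,2), of j] by simp
  ultimately show ?thesis
    by (subst d) (intro sum.cong refl, simp)
qed

text \<open>Parseval's identity turns the integral into a sum of squares divided by positive norms.
  Some coefficient is nonzero, since otherwise the expansion would make p zero; no argument about
  null sets is needed.\<close>

lemma jacobi_integral_square_pos:
  assumes "\<alpha> > -1" "\<beta> > -1" "p \<noteq> 0"
  shows "jacobi_integral \<alpha> \<beta> (p * p) > 0"
proof -
  define c where "c j = jacobi_integral \<alpha> \<beta> (p * jacobi_poly \<alpha> \<beta> j)" for j
  let ?\<gamma> = "jacobi_gamma \<alpha> \<beta>"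
  have p: "p = (\<Sum>j\<le>degree p. smult (c j / ?\<gamma> j) (jacobi_poly \<alpha> \<beta> j))"
    unfolding c_def by (rule jacobi_expansion) (use assms in auto)
  have "p * p = (\<Sum>j\<le>degree p. smult (c j / ?\<gamma> j) (p * jacobi_poly \<alpha> \<beta> j))"
    by (subst p) (simp add: sum_distrib_left sum_distrib_right mult.commute)
  then have eq: "jacobi_integral \<alpha> \<beta> (p * p) = (\<Sum>j\<le>degree p. c j ^ 2 / ?\<gamma> j)"
    by (simp add: jacobi_integral_sum [OF assms(1,2)] jacobi_integral_smult power2_eq_square
        flip: c_def)
  obtain j where "j \<le> degree p" "c j \<noteq> 0"
    using p assms(3) by (metis (no_types, lifting) atMost_iff div_0 smult_0_left sum.neutral)
  with jacobi_gamma_pos [OF assms(1,2)] show ?thesis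
    unfolding eq by (intro sum_pos2 [of _ j]) (auto simp: less_imp_le)
qed

subsection \<open>Erdelyi--Kober operators on powers\<close>

text \<open>The substitution \<open>s = (t / x) powr \<sigma>\<close> turns the kernel into the Beta
  integrand; C collects the powers of x and the factor \<open>1 / \<sigma>\<close> that it
  releases.\<close>

lemma EK_kernel_power_integral:
  fixes \<nu> \<sigma> a x :: real
  assumes "\<nu> > 0" "\<sigma> > 0" "a > 0" "x > 0"
  defines "h \<equiv> (\<lambda>t. (x powr \<sigma> - t powr \<sigma>) powr (\<nu> - 1) * t powr (\<sigma> * a - 1))"
  shows "set_integrable lborel {0<..<x} h"
    and "(LINT t:{0<..<x}|lborel. h t) = x powr (\<sigma> * (a + \<nu> - 1)) / \<sigma> * Beta a \<nu>"
proof -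
  define C where "C = x powr (\<sigma> * (a + \<nu> - 1)) / \<sigma>"
  define g where "g = (\<lambda>t. (t / x) powr \<sigma>)"
  define g' where "g' = (\<lambda>t. \<sigma> * (t / x) powr (\<sigma> - 1) / x)"
  have C: "C > 0" using assms by (simp add: C_def)
  have img: "g ` {0<..<x} = {0<..<1}"
  proof safe
    fix t assume "t \<in> {0<..<x}"
    then show "g t \<in> {0<..<1}"
      using assms powr_less_mono2 [of \<sigma> "t / x" 1] by (simp add: g_def)
  next
    fix s :: real assume s: "s \<in> {0<..<1}"
    then have "s powr (1 / \<sigma>) < 1"
      using assms powr_less_mono2 [of "1 / \<sigma>" s 1] by simp
    with s show "s \<in> g ` {0<..<x}"
      using assms by (intro image_eqI [of _ _ "x * s powr (1 / \<sigma>)"]) (auto simp: g_def powr_powr)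
  qed
  have der: "(g has_field_derivative g' t) (at t within {0<..<x})" if "t \<in> {0<..<x}" for t
    unfolding g_def g'_def using that assms by (auto intro!: derivative_eq_intros)
  have inj: "inj_on g {0<..<x}"
  proof (rule inj_onI)
    fix s t assume st: "s \<in> {0<..<x}" "t \<in> {0<..<x}" "g s = g t"
    then have "((s / x) powr \<sigma>) powr (1 / \<sigma>) = ((t / x) powr \<sigma>) powr (1 / \<sigma>)"
      by (simp add: g_def)
    with st assms show "s = t" by (simp add: powr_powr)
  qed
  have eq: "h t / C = \<bar>g' t\<bar> * (g t powr (a - 1) * (1 - g t) powr (\<nu> - 1))"
    if t: "t \<in> {0<..<x}" for t
  proof -
    have "t powr \<sigma> < x powr \<sigma>"
      using t assms by (intro powr_less_mono2) auto
    moreover have "1 - g t = (x powr \<sigma> - t powr \<sigma>) / x powr \<sigma>"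
      using t assms by (simp add: g_def powr_divide diff_divide_distrib)
    ultimately have 1: "(1 - g t) powr (\<nu> - 1) =
        (x powr \<sigma> - t powr \<sigma>) powr (\<nu> - 1) / x powr (\<sigma> * (\<nu> - 1))"
      using assms by (simp add: powr_divide powr_powr)
    have 2: "g t powr (a - 1) = t powr (\<sigma> * (a - 1)) / x powr (\<sigma> * (a - 1))"
      using t assms by (simp add: g_def powr_powr powr_divide)
    have 3: "\<bar>g' t\<bar> = \<sigma> * t powr (\<sigma> - 1) / x powr \<sigma>"
      using t assms by (simp add: g'_def powr_divide powr_diff field_simps)
    have 4: "t powr (\<sigma> * a - 1) = t powr (\<sigma> * (a - 1)) * t powr (\<sigma> - 1)"
      by (simp add: powr_add [symmetric] algebra_simps)
    have 5: "C = x powr (\<sigma> * (a - 1)) * x powr (\<sigma> * (\<nu> - 1)) * x powr \<sigma> / \<sigma>"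
      by (simp add: C_def powr_add [symmetric] algebra_simps)
    show ?thesis
      unfolding h_def 1 2 3 4 5 using assms by (simp add: mult_ac)
  qed
  have meas: "(\<lambda>t. h t / C) \<in> borel_measurable lborel"
    unfolding h_def by measurable
  note subst = Beta_integral_substitution [of a \<nu> "{0<..<x}" g g' "\<lambda>t. h t / C"]
  have "set_integrable lborel {0<..<x} (\<lambda>t. h t / C)"
    by (rule subst(1)) (use assms meas der inj img eq in auto)
  moreover have "(LINT t:{0<..<x}|lborel. h t / C) = Beta a \<nu>"
    by (rule subst(2)) (use assms meas der inj img eq in auto)
  ultimately show "set_integrable lborel {0<..<x} h"
    "(LINT t:{0<..<x}|lborel. h t) = x powr (\<sigma> * (a + \<nu> - 1)) / \<sigma> * Beta a \<nu>"
    unfolding C_def [symmetric] using C by (simp_all add: field_simps)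
qed

text \<open>Each power is an eigenfunction. The bound on \<open>\<eta> + e i\<close> is convergence
  of the integral at 0. The case \<open>\<nu> = 0\<close>, which occurs for integer orders of
  differentiation, fits the same formula with Gamma quotient 1.\<close>

lemma EK_integral_powr_sum:
  fixes q e :: "'i \<Rightarrow> real"
  assumes "\<nu> \<ge> 0" "\<sigma> > 0" "x > 0"
    and e: "\<And>i. i \<in> I \<Longrightarrow> \<eta> + e i > -1"
    and f: "\<And>z. z > 0 \<Longrightarrow> f z = (\<Sum>i\<in>I. q i * z powr (\<sigma> * e i))"
  shows "EK_integral \<nu> \<sigma> \<eta> f x =
    (\<Sum>i\<in>I. q i * (Gamma (\<eta> + e i + 1) / Gamma (\<eta> + e i + \<nu> + 1)) * x powr (\<sigma> * e i))"
proof (cases "\<nu> = 0")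
  case True
  have "Gamma (\<eta> + e i + 1) \<noteq> 0" if "i \<in> I" for i
    using Gamma_real_neq_0 [of "\<eta> + e i + 1"] e [OF that] by simp
  then show ?thesis
    using True f [OF assms(3)] by (auto simp: EK_integral_def intro!: sum.cong)
next
  case False
  then have \<nu>: "\<nu> > 0" using assms by simp
  let ?h = "\<lambda>i t. (x powr \<sigma> - t powr \<sigma>) powr (\<nu> - 1) * t powr (\<sigma> * (\<eta> + e i + 1) - 1)"
  have pos: "\<eta> + e i + 1 > 0" if "i \<in> I" for i
    using e [OF that] by simp
  have "(LINT t:{0<..<x}|lborel.
        (x powr \<sigma> - t powr \<sigma>) powr (\<nu> - 1) * t powr (\<sigma> * (\<eta> + 1) - 1) * f t) =
      (LINT t:{0<..<x}|lborel. \<Sum>i\<in>I. q i * ?h i t)"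
  proof (rule set_lebesgue_integral_cong)
    show "\<forall>t. t \<in> {0<..<x} \<longrightarrow>
        (x powr \<sigma> - t powr \<sigma>) powr (\<nu> - 1) * t powr (\<sigma> * (\<eta> + 1) - 1) * f t =
        (\<Sum>i\<in>I. q i * ?h i t)"
    proof safe
      fix t assume t: "t \<in> {0<..<x}"
      have "t powr (\<sigma> * (\<eta> + e i + 1) - 1) = t powr (\<sigma> * (\<eta> + 1) - 1) * t powr (\<sigma> * e i)" for i
        by (simp add: powr_add [symmetric] algebra_simps)
      with t show "(x powr \<sigma> - t powr \<sigma>) powr (\<nu> - 1) * t powr (\<sigma> * (\<eta> + 1) - 1) * f t =
          (\<Sum>i\<in>I. q i * ?h i t)"
        by (simp add: f sum_distrib_left mult_ac)
    qed
  qed auto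
  also have "\<dots> = (\<Sum>i\<in>I. LINT t:{0<..<x}|lborel. q i * ?h i t)"
    using EK_kernel_power_integral(1) [OF \<nu> assms(2) pos assms(3)]
    by (intro set_integral_sum_real(2) set_integrable_mult_right)
  also have "\<dots> = (\<Sum>i\<in>I. q i *
      (x powr (\<sigma> * (\<eta> + e i + 1 + \<nu> - 1)) / \<sigma> * Beta (\<eta> + e i + 1) \<nu>))"
    using EK_kernel_power_integral(2) [OF \<nu> assms(2) pos assms(3)]
    by (intro sum.cong refl) (simp only: set_integral_mult_right)
  finally have "EK_integral \<nu> \<sigma> \<eta> f x = \<sigma> * x powr (- \<sigma> * (\<eta> + \<nu>)) / Gamma \<nu> *
      (\<Sum>i\<in>I. q i * (x powr (\<sigma> * (\<eta> + e i + 1 + \<nu> - 1)) / \<sigma> * Beta (\<eta> + e i + 1) \<nu>))"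
    using False by (simp add: EK_integral_def)
  also have "\<dots> = (\<Sum>i\<in>I. q i * (Gamma (\<eta> + e i + 1) / Gamma (\<eta> + e i + \<nu> + 1)) * x powr (\<sigma> * e i))"
    unfolding sum_distrib_left
  proof (intro sum.cong refl)
    fix i
    have "x powr (\<sigma> * (\<eta> + e i + 1 + \<nu> - 1)) = x powr (\<sigma> * (\<eta> + \<nu>)) * x powr (\<sigma> * e i)"
      by (simp add: powr_add [symmetric] algebra_simps)
    moreover have "x powr (- \<sigma> * (\<eta> + \<nu>)) * x powr (\<sigma> * (\<eta> + \<nu>)) = 1"
      using assms by (simp add: powr_add [symmetric])
    moreover have "Gamma \<nu> \<noteq> 0"
      using Gamma_real_neq_0 [OF \<nu>] by simp
    ultimately show "\<sigma> * x powr (- \<sigma> * (\<eta> + \<nu>)) / Gamma \<nu> *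
        (q i * (x powr (\<sigma> * (\<eta> + e i + 1 + \<nu> - 1)) / \<sigma> * Beta (\<eta> + e i + 1) \<nu>)) =
        q i * (Gamma (\<eta> + e i + 1) / Gamma (\<eta> + e i + \<nu> + 1)) * x powr (\<sigma> * e i)"
      using assms(2) by (simp add: Beta_def add_ac)
  qed
  finally show ?thesis .
qed

text \<open>The operator is differentiation with respect to \<open>z powr \<sigma>\<close>: it sends
  \<open>z powr (\<sigma> * r)\<close> to r times \<open>z powr (\<sigma> * (r - 1))\<close>. The
  factors r accumulate to a Gamma quotient, and \<open>m \<le> n\<close> with
  \<open>p i > -1\<close> keeps each of them positive.\<close>

lemma iterated_EK_differential_powr_sum:
  fixes q p :: "'i \<Rightarrow> real"
  assumes "\<sigma> > 0" "m \<le> n" "z > 0"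
    and p: "\<And>i. i \<in> I \<Longrightarrow> p i > -1"
    and G: "\<And>z. z > 0 \<Longrightarrow> G z = (\<Sum>i\<in>I. q i * z powr (\<sigma> * (p i + real n)))"
  shows "((\<lambda>g z. 1 / (\<sigma> * z powr (\<sigma> - 1)) * deriv g z) ^^ m) G z =
    (\<Sum>i\<in>I. q i * (Gamma (p i + real n + 1) / Gamma (p i + real (n - m) + 1)) *
       z powr (\<sigma> * (p i + real (n - m))))"
  using assms(2,3)
proof (induction m arbitrary: z)
  case 0
  have "Gamma (p i + real n + 1) \<noteq> 0" if "i \<in> I" for i
    using Gamma_real_neq_0 [of "p i + real n + 1"] p [OF that] by simp
  then show ?case
    using 0 by (simp add: G)
next
  case (Suc m)
  let ?F = "((\<lambda>g z. 1 / (\<sigma> * z powr (\<sigma> - 1)) * deriv g z) ^^ m) G"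
  let ?c = "\<lambda>i. q i * (Gamma (p i + real n + 1) / Gamma (p i + real (n - m) + 1))"
  let ?r = "\<lambda>i. p i + real (n - m)"
  have "((\<lambda>z. z powr (\<sigma> * r)) has_real_derivative \<sigma> * r * z powr (\<sigma> * r - 1)) (at z)" for r
    using Suc.prems by (auto intro!: derivative_eq_intros)
  then have deriv: "((\<lambda>z. \<Sum>i\<in>I. ?c i * z powr (\<sigma> * ?r i)) has_real_derivative
      (\<Sum>i\<in>I. ?c i * (\<sigma> * ?r i * z powr (\<sigma> * ?r i - 1)))) (at z)"
    by (intro DERIV_sum DERIV_cmult)
  have "(\<Sum>i\<in>I. ?c i * z powr (\<sigma> * ?r i)) = ?F z" if "z \<in> {0<..}" for z
    using Suc.IH [of z] Suc.prems that by simp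
  \<comment> \<open>The previous iterate is known only for positive arguments; that set is open, so
    the derivative at z can be transferred. This is why the induction leaves z arbitrary.\<close>
  then have "(?F has_real_derivative (\<Sum>i\<in>I. ?c i * (\<sigma> * ?r i * z powr (\<sigma> * ?r i - 1)))) (at z)"
    using Suc.prems by (intro has_field_derivative_transform_within_open [OF deriv, of "{0<..}"]) auto
  then have "deriv ?F z = (\<Sum>i\<in>I. ?c i * (\<sigma> * ?r i * z powr (\<sigma> * ?r i - 1)))"
    by (rule DERIV_imp_deriv)
  then have "((\<lambda>g z. 1 / (\<sigma> * z powr (\<sigma> - 1)) * deriv g z) ^^ Suc m) G z =
      (\<Sum>i\<in>I. 1 / (\<sigma> * z powr (\<sigma> - 1)) * (?c i * (\<sigma> * ?r i * z powr (\<sigma> * ?r i - 1))))"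
    by (simp only: funpow.simps o_apply sum_distrib_left)
  also have "\<dots> = (\<Sum>i\<in>I. q i * (Gamma (p i + real n + 1) / Gamma (p i + real (n - Suc m) + 1)) *
       z powr (\<sigma> * (p i + real (n - Suc m))))"
  proof (intro sum.cong refl)
    fix i assume i: "i \<in> I"
    have r: "?r i = p i + real (n - Suc m) + 1"
      using Suc.prems by (simp add: of_nat_diff)
    have pos: "?r i > 0"
      unfolding r using p [OF i] by linarith
    have "Gamma (?r i + 1) = ?r i * Gamma (p i + real (n - Suc m) + 1)"
      using Gamma_plus1 [OF pos_not_nonpos_Ints, OF pos] r by simp
    moreover have "z powr (\<sigma> * ?r i - 1) =
        z powr (\<sigma> - 1) * z powr (\<sigma> * (p i + real (n - Suc m)))"
      unfolding r by (simp add: powr_add [symmetric] algebra_simps)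
    ultimately show "1 / (\<sigma> * z powr (\<sigma> - 1)) * (?c i * (\<sigma> * ?r i * z powr (\<sigma> * ?r i - 1))) =
        q i * (Gamma (p i + real n + 1) / Gamma (p i + real (n - Suc m) + 1)) *
        z powr (\<sigma> * (p i + real (n - Suc m)))"
      using pos assms(1) Suc.prems by simp
  qed
  finally show ?case .
qed

text \<open>The fractional integral leaves \<open>Gamma (\<eta> + e i + n + 1)\<close> in the
  denominator and the n differentiations put it into the numerator, so the auxiliary integer n
  cancels.\<close>

lemma EK_derivative_powr_sum:
  fixes q e :: "'i \<Rightarrow> real"
  assumes "\<mu> > 0" "\<sigma> > 0" "x > 0"
    and e: "\<And>i. i \<in> I \<Longrightarrow> \<eta> + e i > -1"
    and f: "\<And>z. z > 0 \<Longrightarrow> f z = (\<Sum>i\<in>I. q i * z powr (\<sigma> * e i))"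
  shows "EK_derivative \<mu> \<sigma> \<eta> f x =
    (\<Sum>i\<in>I. q i * (Gamma (\<eta> + \<mu> + e i + 1) / Gamma (\<eta> + e i + 1)) * x powr (\<sigma> * e i))"
proof -
  define n where "n = nat \<lceil>\<mu>\<rceil>"
  have n: "real n - \<mu> \<ge> 0"
    unfolding n_def using real_nat_ceiling_ge [of \<mu>] by simp
  let ?K = "\<lambda>i. q i * (Gamma (\<eta> + \<mu> + e i + 1) / Gamma (\<eta> + e i + real n + 1))"
  let ?G = "\<lambda>z. z powr (\<sigma> * (\<eta> + real n)) * EK_integral (real n - \<mu>) \<sigma> (\<eta> + \<mu>) f z"
  have G: "?G z = (\<Sum>i\<in>I. ?K i * z powr (\<sigma> * (\<eta> + e i + real n)))" if z: "z > 0" for z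
  proof -
    have "EK_integral (real n - \<mu>) \<sigma> (\<eta> + \<mu>) f z = (\<Sum>i\<in>I. q i *
        (Gamma (\<eta> + \<mu> + e i + 1) / Gamma (\<eta> + \<mu> + e i + (real n - \<mu>) + 1)) * z powr (\<sigma> * e i))"
    proof (rule EK_integral_powr_sum [OF n assms(2) z _ f])
      show "\<eta> + \<mu> + e i > -1" if "i \<in> I" for i
        using e [OF that] assms(1) by linarith
    qed
    moreover have "z powr (\<sigma> * (\<eta> + e i + real n)) = z powr (\<sigma> * (\<eta> + real n)) * z powr (\<sigma> * e i)" for i
      by (simp add: powr_add [symmetric] algebra_simps)
    moreover have "\<eta> + \<mu> + e i + (real n - \<mu>) + 1 = \<eta> + e i + real n + 1" for i
      by simp
    ultimately show ?thesis
      by (simp only: sum_distrib_left mult_ac)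
  qed
  have "EK_derivative \<mu> \<sigma> \<eta> f x = x powr (- \<sigma> * \<eta>) *
      (\<Sum>i\<in>I. ?K i * (Gamma (\<eta> + e i + real n + 1) / Gamma (\<eta> + e i + real (n - n) + 1)) *
        x powr (\<sigma> * (\<eta> + e i + real (n - n))))"
    unfolding EK_derivative_def Let_def n_def [symmetric]
    by (subst iterated_EK_differential_powr_sum [OF assms(2) order_refl assms(3) e G]) simp_all
  also have "\<dots> = (\<Sum>i\<in>I. q i * (Gamma (\<eta> + \<mu> + e i + 1) / Gamma (\<eta> + e i + 1)) * x powr (\<sigma> * e i))"
    unfolding sum_distrib_left
  proof (intro sum.cong refl)
    fix i assume "i \<in> I"
    then have "Gamma (\<eta> + e i + real n + 1) \<noteq> 0"
      using Gamma_real_neq_0 [of "\<eta> + e i + real n + 1"] e [of i] by simp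
    moreover have "x powr (- \<sigma> * \<eta>) * x powr (\<sigma> * (\<eta> + e i)) = x powr (\<sigma> * e i)"
      by (simp add: powr_add [symmetric] algebra_simps)
    ultimately show "x powr (- \<sigma> * \<eta>) * (?K i *
        (Gamma (\<eta> + e i + real n + 1) / Gamma (\<eta> + e i + real (n - n) + 1)) *
        x powr (\<sigma> * (\<eta> + e i + real (n - n)))) =
        q i * (Gamma (\<eta> + \<mu> + e i + 1) / Gamma (\<eta> + e i + 1)) * x powr (\<sigma> * e i)"
      by (simp add: mult_ac)
  qed
  finally show ?thesis .
qed

subsection \<open>Gauss--Jacobi nodes and Lagrange interpolation\<close>

lemma gauss_jacobi_quadratureD:
  assumes "gauss_jacobi_quadrature \<alpha> \<beta> N y u" "degree p \<le> 2 * N + 1"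
  shows "jacobi_integral \<alpha> \<beta> p = (\<Sum>r\<le>N. u r * poly p (y r))"
  using assms unfolding gauss_jacobi_quadrature_def jacobi_integral_def by blast

lemma degree_prod_linear_le:
  fixes f :: "nat \<Rightarrow> real poly"
  assumes "i \<le> N" "\<And>j. degree (f j) \<le> 1"
  shows "degree (\<Prod>j\<in>{..N} - {i}. f j) \<le> N"
proof -
  have "degree (\<Prod>j\<in>{..N} - {i}. f j) \<le> (\<Sum>j\<in>{..N} - {i}. degree (f j))"
    using degree_prod_sum_le [of "{..N} - {i}" f] by (simp add: o_def)
  also have "\<dots> \<le> (\<Sum>j\<in>{..N} - {i}. 1)"
    by (intro sum_mono assms)
  also have "\<dots> = N"
    using assms by simp
  finally show ?thesis .
qed

text \<open>A node at \<open>-1\<close> would make the rule vanish on \<open>(1 + t) q\<^sup>2\<close>, where \<open>q\<close> has the other nodes as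
  zeros; but \<open>1 + t\<close> can be absorbed into the weight, so the integral is positive.\<close>

lemma gauss_jacobi_node_greater:
  assumes "\<alpha> > -1" "\<beta> > -1" "gauss_jacobi_quadrature \<alpha> \<beta> N y u" "i \<le> N"
  shows "-1 < y i"
proof (rule ccontr)
  assume "\<not> -1 < y i"
  moreover have "-1 \<le> y i"
    using assms(3,4) by (auto simp: gauss_jacobi_quadrature_def image_subset_iff)
  ultimately have y: "y i = -1" by simp
  define q where "q = (\<Prod>j\<in>{..N} - {i}. [:- y j, 1:])"
  have "q \<noteq> 0" by (simp add: q_def)
  have deg: "degree q \<le> N"
    unfolding q_def using assms(4) by (rule degree_prod_linear_le) simp
  have node: "poly q (y r) = 0" if "r \<le> N" "r \<noteq> i" for r
    using that by (auto simp: q_def poly_prod)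
  \<comment> \<open>A linear factor times a square of degree at most 2N just meets the limit of
    exactness.\<close>
  have "degree ([:1, 1:] * (q * q)) \<le> degree [:1, 1 :: real:] + (degree q + degree q)"
    by (rule order.trans [OF degree_mult_le add_left_mono [OF degree_mult_le]])
  then have "degree ([:1, 1:] * (q * q)) \<le> 2 * N + 1"
    using deg by simp
  then have "jacobi_integral \<alpha> \<beta> ([:1, 1:] * (q * q)) =
      (\<Sum>r\<le>N. u r * poly ([:1, 1:] * (q * q)) (y r))"
    by (rule gauss_jacobi_quadratureD [OF assms(3)])
  also have "\<dots> = 0"
  proof (intro sum.neutral ballI)
    fix r assume "r \<in> {..N}"
    then show "u r * poly ([:1, 1:] * (q * q)) (y r) = 0"
      using node [of r] y by (cases "r = i") auto
  qed
  also have "jacobi_integral \<alpha> \<beta> ([:1, 1:] * (q * q)) = jacobi_integral \<alpha> (\<beta> + 1) (q * q)"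
    unfolding jacobi_integral_def
  proof (intro set_lebesgue_integral_cong allI impI)
    fix t :: real assume "t \<in> {-1..1}"
    then have absorb: "(1 + t) powr (\<beta> + 1) = (1 + t) powr \<beta> * (1 + t)"
      by (simp add: powr_add)
    have linear: "poly ([:1, 1:] * (q * q)) t = (1 + t) * poly (q * q) t"
      by (simp add: algebra_simps)
    show "(1 - t) powr \<alpha> * (1 + t) powr \<beta> * poly ([:1, 1:] * (q * q)) t =
        (1 - t) powr \<alpha> * (1 + t) powr (\<beta> + 1) * poly (q * q) t"
      unfolding linear absorb by simp
  qed simp
  finally show False
    using jacobi_integral_square_pos [of \<alpha> "\<beta> + 1" q] assms \<open>q \<noteq> 0\<close> by simp
qed

text \<open>Used with two node families: the quadrature nodes y, to expand the interpolant, and the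
  mapped nodes x, as test functions that isolate a matrix entry.\<close>

definition lagrange_poly :: "nat \<Rightarrow> (nat \<Rightarrow> real) \<Rightarrow> nat \<Rightarrow> real poly" where
  "lagrange_poly N y i = (\<Prod>j\<in>{..N} - {i}. smult (1 / (y i - y j)) [:- y j, 1:])"

lemma poly_lagrange_poly:
  "poly (lagrange_poly N y i) t = (\<Prod>j\<in>{..N} - {i}. (t - y j) / (y i - y j))"
  by (simp add: lagrange_poly_def poly_prod diff_divide_distrib)

lemma lagrange_poly_node:
  assumes "inj_on y {..N}" "i \<le> N" "r \<le> N"
  shows "poly (lagrange_poly N y i) (y r) = (if r = i then 1 else 0)"
proof (cases "r = i")
  case True
  have "y i - y j \<noteq> 0" if "j \<in> {..N} - {i}" for j
    using assms that by (auto dest: inj_onD)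
  with True show ?thesis by (simp add: poly_lagrange_poly)
next
  case False
  with assms show ?thesis
    by (auto simp: poly_lagrange_poly intro!: bexI [of _ r])
qed

text \<open>The product with a Jacobi polynomial of degree at most N has degree at most 2N, hence is
  integrated exactly, and the Lagrange property leaves one term of the quadrature sum.\<close>

lemma lagrange_poly_jacobi_expansion:
  assumes "\<alpha> > -1" "\<beta> > -1" "gauss_jacobi_quadrature \<alpha> \<beta> N y u" "i \<le> N"
  shows "lagrange_poly N y i =
    (\<Sum>j\<le>N. smult (u i * poly (jacobi_poly \<alpha> \<beta> j) (y i) / jacobi_gamma \<alpha> \<beta> j) (jacobi_poly \<alpha> \<beta> j))"
proof -
  let ?l = "lagrange_poly N y i"
  have inj: "inj_on y {..N}"
    using assms(3) by (simp add: gauss_jacobi_quadrature_def)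
  have deg: "degree ?l \<le> N"
    unfolding lagrange_poly_def using assms(4) by (rule degree_prod_linear_le) simp
  have "jacobi_integral \<alpha> \<beta> (?l * jacobi_poly \<alpha> \<beta> j) = u i * poly (jacobi_poly \<alpha> \<beta> j) (y i)"
    if "j \<le> N" for j
  proof -
    have "degree (?l * jacobi_poly \<alpha> \<beta> j) \<le> 2 * N + 1"
      using degree_mult_le [of ?l "jacobi_poly \<alpha> \<beta> j"] degree_jacobi_poly_le [of \<alpha> \<beta> j] deg that
      by linarith
    then have "jacobi_integral \<alpha> \<beta> (?l * jacobi_poly \<alpha> \<beta> j) =
        (\<Sum>r\<le>N. u r * poly (?l * jacobi_poly \<alpha> \<beta> j) (y r))"
      by (rule gauss_jacobi_quadratureD [OF assms(3)])
    also have "\<dots> = (\<Sum>r\<le>N. if r = i then u i * poly (jacobi_poly \<alpha> \<beta> j) (y i) else 0)"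
      using inj assms(4) by (intro sum.cong refl) (simp add: lagrange_poly_node)
    finally show ?thesis using assms(4) by simp
  qed
  then have "(\<Sum>j\<le>N. smult (jacobi_integral \<alpha> \<beta> (?l * jacobi_poly \<alpha> \<beta> j) / jacobi_gamma \<alpha> \<beta> j)
      (jacobi_poly \<alpha> \<beta> j)) =
      (\<Sum>j\<le>N. smult (u i * poly (jacobi_poly \<alpha> \<beta> j) (y i) / jacobi_gamma \<alpha> \<beta> j)
        (jacobi_poly \<alpha> \<beta> j))"
    by (intro sum.cong refl) simp
  with jacobi_expansion [OF assms(1,2) deg] show ?thesis by simp
qed

subsection \<open>Jacobi--Muentz functions\<close>

lemma jacobi_muntz1_powr_sum:
  assumes "b > 0" "z > 0"
  shows "jacobi_muntz1 b \<alpha> \<beta> \<mu> \<sigma> \<eta> n z =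
    (\<Sum>m\<le>n. jacobi_coeff \<alpha> \<beta> n m / b powr (\<sigma> * real m) * z powr (\<sigma> * (\<beta> - \<eta> - \<mu> + real m)))"
proof -
  have "z powr (\<sigma> * (\<beta> - \<eta> - \<mu>)) * ((z / b) powr \<sigma>) ^ m =
      z powr (\<sigma> * (\<beta> - \<eta> - \<mu> + real m)) / b powr (\<sigma> * real m)" for m
  proof -
    have "((z / b) powr \<sigma>) ^ m = z powr (\<sigma> * real m) / b powr (\<sigma> * real m)"
      using assms by (simp add: powr_powr powr_divide flip: powr_realpow)
    then show ?thesis
      by (simp add: ring_distribs powr_add)
  qed
  then show ?thesis
    unfolding jacobi_muntz1_def mapped_jacobi_def poly_jacobi_poly_shifted
    by (simp add: sum_distrib_left mult.left_commute)
qed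

text \<open>The parameter \<open>\<eta> - \<mu>\<close> on the right compensates
  \<open>\<beta> - \<mu>\<close>: since \<open>(\<beta> - \<mu>) - (\<eta> - \<mu>) - \<mu> =
  \<beta> - \<eta> - \<mu>\<close>, the powers of x are unchanged and only the polynomial
  coefficients have to be compared.\<close>

lemma EK_derivative_jacobi_muntz1_sum:
  assumes "b > 0" "\<sigma> > 0" "\<beta> > -1" "\<mu> > 0" "\<beta> - \<mu> > -1" "x > 0"
    and f: "\<And>z. z > 0 \<Longrightarrow> f z = (\<Sum>j\<le>N. d j * jacobi_muntz1 b \<alpha> \<beta> \<mu> \<sigma> \<eta> j z)"
  shows "EK_derivative \<mu> \<sigma> \<eta> f x =
    (\<Sum>j\<le>N. d j * (Gamma (real j + \<beta> + 1) / Gamma (real j + \<beta> - \<mu> + 1)) *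
       jacobi_muntz1 b (\<alpha> + \<mu>) (\<beta> - \<mu>) \<mu> \<sigma> (\<eta> - \<mu>) j x)"
proof -
  \<comment> \<open>The double sum over degrees and powers is flattened so that the power-sum
    formula applies once to the whole function.\<close>
  let ?I = "SIGMA j:{..N}. {..j}"
  define q where "q = (\<lambda>(j, m). d j * (jacobi_coeff \<alpha> \<beta> j m / b powr (\<sigma> * real m)))"
  define e where "e = (\<lambda>(j::nat, m::nat). \<beta> - \<eta> - \<mu> + real m)"
  have sum_I: "(\<Sum>i\<in>?I. g i) = (\<Sum>j\<le>N. \<Sum>m\<le>j. g (j, m))" for g :: "nat \<times> nat \<Rightarrow> real"
    by (subst sum.Sigma) auto
  have "EK_derivative \<mu> \<sigma> \<eta> f x = (\<Sum>i\<in>?I. q i *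
      (Gamma (\<eta> + \<mu> + e i + 1) / Gamma (\<eta> + e i + 1)) * x powr (\<sigma> * e i))"
  proof (rule EK_derivative_powr_sum [OF assms(4,2,6)])
    show "\<eta> + e i > -1" for i
      using assms(5) by (cases i) (auto simp: e_def)
    show "f z = (\<Sum>i\<in>?I. q i * z powr (\<sigma> * e i))" if z: "z > 0" for z
      unfolding f [OF z] jacobi_muntz1_powr_sum [OF assms(1) z] sum_I q_def e_def
      by (simp add: sum_distrib_left mult.assoc)
  qed
  also have "\<dots> = (\<Sum>j\<le>N. \<Sum>m\<le>j. d j * (jacobi_coeff \<alpha> \<beta> j m / b powr (\<sigma> * real m)) *
      (Gamma (\<beta> + real m + 1) / Gamma (\<beta> - \<mu> + real m + 1)) *
      x powr (\<sigma> * (\<beta> - \<eta> - \<mu> + real m)))"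
    unfolding sum_I q_def e_def by (simp add: algebra_simps)
  also have "\<dots> = (\<Sum>j\<le>N. d j * (Gamma (real j + \<beta> + 1) / Gamma (real j + \<beta> - \<mu> + 1)) *
       jacobi_muntz1 b (\<alpha> + \<mu>) (\<beta> - \<mu>) \<mu> \<sigma> (\<eta> - \<mu>) j x)"
    unfolding jacobi_muntz1_powr_sum [OF assms(1,6)] sum_distrib_left
  proof (intro sum.cong refl)
    fix j m :: nat assume "m \<in> {..j}"
    then have m: "m \<le> j" by simp
    have exponent: "\<beta> - \<mu> - (\<eta> - \<mu>) - \<mu> + real m = \<beta> - \<eta> - \<mu> + real m" by simp
    have "d j * (jacobi_coeff \<alpha> \<beta> j m / b powr (\<sigma> * real m)) *
        (Gamma (\<beta> + real m + 1) / Gamma (\<beta> - \<mu> + real m + 1)) *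
        x powr (\<sigma> * (\<beta> - \<eta> - \<mu> + real m)) =
        d j / b powr (\<sigma> * real m) * x powr (\<sigma> * (\<beta> - \<eta> - \<mu> + real m)) *
        (jacobi_coeff \<alpha> \<beta> j m * (Gamma (\<beta> + real m + 1) / Gamma (\<beta> - \<mu> + real m + 1)))"
      by (simp add: mult_ac)
    then show "d j * (jacobi_coeff \<alpha> \<beta> j m / b powr (\<sigma> * real m)) *
        (Gamma (\<beta> + real m + 1) / Gamma (\<beta> - \<mu> + real m + 1)) *
        x powr (\<sigma> * (\<beta> - \<eta> - \<mu> + real m)) =
        d j * (Gamma (real j + \<beta> + 1) / Gamma (real j + \<beta> - \<mu> + 1)) *
        (jacobi_coeff (\<alpha> + \<mu>) (\<beta> - \<mu>) j m / b powr (\<sigma> * real m) *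
        x powr (\<sigma> * (\<beta> - \<mu> - (\<eta> - \<mu>) - \<mu> + real m)))"
      unfolding jacobi_coeff_shift_parameters [OF assms(3,5) m] exponent
      by (simp add: mult_ac)
  qed
  finally show ?thesis .
qed

section \<open>Transfer to the mapped nodes\<close>

lemma mapped_node_powr:
  assumes "b > 0" "\<sigma> > 0" "t > -1"
  shows "mapped_node b \<sigma> t powr \<sigma> = b powr \<sigma> * ((1 + t) / 2)"
  using assms by (simp add: mapped_node_def powr_mult powr_powr)

lemma mapped_node_inverse:
  assumes "b > 0" "\<sigma> > 0" "t > -1"
  shows "2 * (mapped_node b \<sigma> t / b) powr \<sigma> - 1 = t"
  using assms by (simp add: mapped_node_def powr_powr add_divide_distrib)

text \<open>The numbers \<open>z powr \<sigma>\<close> and \<open>x j powr \<sigma>\<close> are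
  images of \<open>2 * (z / b) powr \<sigma> - 1\<close> and \<open>y j\<close> under the same
  affine map, and quotients of differences are invariant under it.\<close>

lemma muntz_lagrange_mapped_node:
  assumes "b > 0" "\<sigma> > 0" "z > 0" and y: "\<And>j. j \<le> N \<Longrightarrow> y j > -1" and "i \<le> N"
  shows "muntz_lagrange \<sigma> N (\<lambda>r. mapped_node b \<sigma> (y r)) i z =
         poly (lagrange_poly N y i) (2 * (z / b) powr \<sigma> - 1)"
  unfolding muntz_lagrange_def poly_lagrange_poly
proof (intro prod.cong refl)
  fix j assume "j \<in> {..N} - {i}"
  then have j: "mapped_node b \<sigma> (y j) powr \<sigma> = b powr \<sigma> * ((1 + y j) / 2)"
    using assms by (intro mapped_node_powr) auto
  have i: "mapped_node b \<sigma> (y i) powr \<sigma> = b powr \<sigma> * ((1 + y i) / 2)"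
    using assms by (intro mapped_node_powr) auto
  let ?Z = "(z / b) powr \<sigma>"
  have "z powr \<sigma> = b powr \<sigma> * ?Z"
    using assms by (simp add: powr_divide)
  then have num: "z powr \<sigma> - b powr \<sigma> * ((1 + y j) / 2) = b powr \<sigma> / 2 * (2 * ?Z - 1 - y j)"
    by (simp add: field_simps)
  have "b powr \<sigma> * ((1 + y i) / 2) - b powr \<sigma> * ((1 + y j) / 2) = b powr \<sigma> / 2 * (y i - y j)"
    by (simp add: field_simps)
  then have "(z powr \<sigma> - mapped_node b \<sigma> (y j) powr \<sigma>) /
      (mapped_node b \<sigma> (y i) powr \<sigma> - mapped_node b \<sigma> (y j) powr \<sigma>) =
      (b powr \<sigma> / 2 * (2 * ?Z - 1 - y j)) / (b powr \<sigma> / 2 * (y i - y j))"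
    by (simp only: i j num)
  also have "\<dots> = (2 * ?Z - 1 - y j) / (y i - y j)"
    using assms by (intro mult_divide_mult_cancel_left) simp
  finally show "(z powr \<sigma> - mapped_node b \<sigma> (y j) powr \<sigma>) /
      (mapped_node b \<sigma> (y i) powr \<sigma> - mapped_node b \<sigma> (y j) powr \<sigma>) =
      (2 * ?Z - 1 - y j) / (y i - y j)" .
qed


text \<open>The equivalence covers existence and uniqueness: the closed form satisfies the defining
  identity, and that identity determines every entry with indices up to N.\<close>

theorem theorem3p18:
  fixes b \<sigma> \<alpha> \<beta> \<eta> \<mu> :: real and N :: nat
    and y u x w :: "nat \<Rightarrow> real" and D :: "nat \<Rightarrow> nat \<Rightarrow> real"
  assumes "b > 0" and "\<sigma> > 0" and "\<alpha> > -1" and "\<beta> > -1" and "\<mu> > 0" and "\<beta> - \<mu> > -1"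
    and "gauss_jacobi_quadrature \<alpha> \<beta> N y u"
    and "x = (\<lambda>r. mapped_node b \<sigma> (y r))"
    and "w = (\<lambda>r. mapped_weight b \<sigma> \<alpha> \<beta> (u r))"
  shows "left_EK_diff_matrix b \<beta> \<mu> \<sigma> \<eta> N x D \<longleftrightarrow>
    (\<forall>s\<le>N. \<forall>i\<le>N. D s i =
       (1 / x i) powr (\<sigma> * (\<beta> - \<eta> - \<mu>)) *
       (\<Sum>j\<le>N. (w i / mapped_jacobi_gamma b \<sigma> \<alpha> \<beta> j * mapped_jacobi b \<sigma> \<alpha> \<beta> j (x i)) *
          (Gamma (real j + \<beta> + 1) / Gamma (real j + \<beta> - \<mu> + 1)) *
          jacobi_muntz1 b (\<alpha> + \<mu>) (\<beta> - \<mu>) \<mu> \<sigma> (\<eta> - \<mu>) j (x s)))"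
proof -
  let ?c = "\<sigma> * (\<beta> - \<eta> - \<mu>)"
  define a where "a i j = w i / mapped_jacobi_gamma b \<sigma> \<alpha> \<beta> j * mapped_jacobi b \<sigma> \<alpha> \<beta> j (x i)" for i j
  define \<Lambda> where "\<Lambda> j = Gamma (real j + \<beta> + 1) / Gamma (real j + \<beta> - \<mu> + 1)" for j
  define J where "J j z = jacobi_muntz1 b (\<alpha> + \<mu>) (\<beta> - \<mu>) \<mu> \<sigma> (\<eta> - \<mu>) j z" for j z
  define E where "E s i = (1 / x i) powr ?c * (\<Sum>j\<le>N. a i j * \<Lambda> j * J j (x s))" for s i
  have y_gt: "-1 < y i" if "i \<le> N" for i
    using gauss_jacobi_node_greater [OF assms(3,4,7) that] .
  have x_pos: "x i > 0" if "i \<le> N" for i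
    using y_gt [OF that] assms(1) by (simp add: assms(8) mapped_node_def)
  have inj: "inj_on x {..N}"
  proof (rule inj_onI)
    fix i j assume ij: "i \<in> {..N}" "j \<in> {..N}" "x i = x j"
    then have "2 * (mapped_node b \<sigma> (y i) / b) powr \<sigma> - 1 = 2 * (mapped_node b \<sigma> (y j) / b) powr \<sigma> - 1"
      by (simp add: assms(8))
    then have "y i = y j"
      using ij(1,2) y_gt by (simp only: mapped_node_inverse [OF assms(1,2)] atMost_iff)
    moreover have "inj_on y {..N}"
      using assms(7) by (simp add: gauss_jacobi_quadrature_def)
    ultimately show "i = j"
      using ij(1,2) by (simp add: inj_on_eq_iff)
  qed
  \<comment> \<open>The same \<open>mapped_factor\<close> scales the weight and the norm, so it
    cancels and the coefficients are those of the unmapped rule.\<close>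
  have a: "a i j = u i * poly (jacobi_poly \<alpha> \<beta> j) (y i) / jacobi_gamma \<alpha> \<beta> j" if "i \<le> N" for i j
  proof -
    have "mapped_factor b \<sigma> \<alpha> \<beta> \<noteq> 0"
      using assms(1,2) by (simp add: mapped_factor_def)
    then show ?thesis
      using mapped_node_inverse [OF assms(1,2) y_gt [OF that]]
      by (simp add: a_def assms(8,9) mapped_weight_def mapped_jacobi_gamma_def mapped_jacobi_def)
  qed
  have interpolant: "muntz_interpolant1 \<beta> \<mu> \<sigma> \<eta> N x v z =
      (\<Sum>j\<le>N. (\<Sum>i\<le>N. v (x i) * (1 / x i) powr ?c * a i j) * jacobi_muntz1 b \<alpha> \<beta> \<mu> \<sigma> \<eta> j z)"
    if z: "z > 0" for v z
  proof -
    have "muntz_interpolant1 \<beta> \<mu> \<sigma> \<eta> N x v z =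
        (\<Sum>i\<le>N. \<Sum>j\<le>N. v (x i) * (1 / x i) powr ?c * a i j * jacobi_muntz1 b \<alpha> \<beta> \<mu> \<sigma> \<eta> j z)"
      unfolding muntz_interpolant1_def
    proof (intro sum.cong refl)
      fix i assume "i \<in> {..N}"
      then have i: "i \<le> N" by simp
      have "muntz_lagrange \<sigma> N x i z = (\<Sum>j\<le>N. a i j * mapped_jacobi b \<sigma> \<alpha> \<beta> j z)"
      proof -
        have "muntz_lagrange \<sigma> N x i z = poly (lagrange_poly N y i) (2 * (z / b) powr \<sigma> - 1)"
          unfolding assms(8) using assms(1,2) z i y_gt
          by (intro muntz_lagrange_mapped_node) auto
        also have "\<dots> = (\<Sum>j\<le>N. a i j * mapped_jacobi b \<sigma> \<alpha> \<beta> j z)"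
          by (simp add: lagrange_poly_jacobi_expansion [OF assms(3,4,7) i] a [OF i]
              poly_sum mapped_jacobi_def)
        finally show ?thesis .
      qed
      moreover have "(z / x i) powr ?c = (1 / x i) powr ?c * z powr ?c"
        using z x_pos [OF i] by (simp add: powr_divide)
      ultimately show "v (x i) * (z / x i) powr ?c * muntz_lagrange \<sigma> N x i z =
          (\<Sum>j\<le>N. v (x i) * (1 / x i) powr ?c * a i j * jacobi_muntz1 b \<alpha> \<beta> \<mu> \<sigma> \<eta> j z)"
        by (simp add: jacobi_muntz1_def sum_distrib_left mult_ac)
    qed
    also have "\<dots> = (\<Sum>j\<le>N. (\<Sum>i\<le>N. v (x i) * (1 / x i) powr ?c * a i j) *
        jacobi_muntz1 b \<alpha> \<beta> \<mu> \<sigma> \<eta> j z)"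
      by (subst sum.swap) (simp add: sum_distrib_right)
    finally show ?thesis .
  qed
  have EK: "EK_derivative \<mu> \<sigma> \<eta> (muntz_interpolant1 \<beta> \<mu> \<sigma> \<eta> N x v) (x s) = (\<Sum>i\<le>N. E s i * v (x i))"
    if s: "s \<le> N" for s v
  proof -
    have "EK_derivative \<mu> \<sigma> \<eta> (muntz_interpolant1 \<beta> \<mu> \<sigma> \<eta> N x v) (x s) =
        (\<Sum>j\<le>N. (\<Sum>i\<le>N. v (x i) * (1 / x i) powr ?c * a i j) * \<Lambda> j * J j (x s))"
      unfolding \<Lambda>_def J_def
      by (rule EK_derivative_jacobi_muntz1_sum [OF assms(1,2,4,5,6) x_pos [OF s] interpolant])
    also have "\<dots> = (\<Sum>i\<le>N. \<Sum>j\<le>N. v (x i) * (1 / x i) powr ?c * a i j * \<Lambda> j * J j (x s))"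
      by (subst sum.swap) (simp add: sum_distrib_right)
    also have "\<dots> = (\<Sum>i\<le>N. E s i * v (x i))"
      by (simp add: E_def sum_distrib_left sum_distrib_right mult_ac)
    finally show ?thesis .
  qed
  have "left_EK_diff_matrix b \<beta> \<mu> \<sigma> \<eta> N x D \<longleftrightarrow> (\<forall>s\<le>N. \<forall>i\<le>N. D s i = E s i)"
  proof
    assume D: "left_EK_diff_matrix b \<beta> \<mu> \<sigma> \<eta> N x D"
    show "\<forall>s\<le>N. \<forall>i\<le>N. D s i = E s i"
    proof (intro allI impI)
      fix s i assume s: "s \<le> N" and i: "i \<le> N"
      \<comment> \<open>A polynomial in x itself, not in \<open>x powr \<sigma>\<close>: it is
        continuous, and since the mapped nodes are distinct it picks out column i on both
        sides.\<close>
      let ?v = "poly (lagrange_poly N x i)"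
      have node: "?v (x r) = (if r = i then 1 else 0)" if "r \<le> N" for r
        using lagrange_poly_node [OF inj i that] .
      have "continuous_on {0<..<b} ?v"
        by (intro continuous_intros)
      with D s have "EK_derivative \<mu> \<sigma> \<eta> (muntz_interpolant1 \<beta> \<mu> \<sigma> \<eta> N x ?v) (x s) =
          (\<Sum>r\<le>N. D s r * ?v (x r))"
        unfolding left_EK_diff_matrix_def by blast
      then have "(\<Sum>r\<le>N. D s r * ?v (x r)) = (\<Sum>r\<le>N. E s r * ?v (x r))"
        by (simp only: EK [OF s])
      moreover have "(\<Sum>r\<le>N. f r * ?v (x r)) = f i" for f :: "nat \<Rightarrow> real"
      proof -
        have "(\<Sum>r\<le>N. f r * ?v (x r)) = (\<Sum>r\<le>N. if r = i then f i else 0)"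
          by (intro sum.cong refl) (simp add: node)
        with i show ?thesis by simp
      qed
      ultimately show "D s i = E s i"
        by simp
    qed
  next
    assume "\<forall>s\<le>N. \<forall>i\<le>N. D s i = E s i"
    then show "left_EK_diff_matrix b \<beta> \<mu> \<sigma> \<eta> N x D"
      unfolding left_EK_diff_matrix_def by (simp add: EK)
  qed
  then show ?thesis
    unfolding E_def a_def \<Lambda>_def J_def .
qed

end
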